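(* Let $G$ be a Frobenius group with Frobenius kernel $N$ and Frobenius complement $H$, so that $G=N\rtimes H$ and $r=\frac{|N|-1}{|H|}$ is a positive integer. Let $\mathcal{S}_0$ be the set of all normal Cayley subsets of $G$, $\mathcal{L}=\{|G|-|S|\,:\,S\in\mathcal{S}_0\}$, \[ l_0=\max\{l\in\mathcal{L}\,:\,l\le 2(\sqrt{|G|}-1)\}, \] and \[ \hat{l}=\max\{l\in\mathcal{L}\,:\,\text{$X(S)$ is Ramanujan for every $S\in\mathcal{S}_0$ with $1\le |G|-|S|\le l$}\}. \] Let $A$ be the set of numbers $\frac{|N|-1-|T|}{|H|}$, where $T$ ranges over all subsets of $N\setminus\{1\}$ that are unions of conjugacy classes of $G$ and are closed under taking inverses. Assume $r\ge 4$. Then: (1) $l_0<|N|$, and there exists $a\in A$ with $a<r$ such that $l_0=1+a|H|$; (2) $\hat{l}=l_0$.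
   Context: A finite group $G$ is a Frobenius group if it has a subgroup $H$ with $1\ne H\ne G$ and $H\cap g^{-1}Hg=\{1\}$ for all $g\in G\setminus H$; then $N=\bigl(G\setminus\bigcup_{g\in G}g^{-1}Hg\bigr)\cup\{1\}$ is a normal subgroup (the Frobenius kernel), $H$ is a Frobenius complement, and $G=N\rtimes H$. A Cayley subset of a finite group $G$ is a subset $S\subset G\setminus\{1\}$ with $S=S^{-1}$ that generates $G$; it is normal if it is a union of conjugacy classes of $G$. The Cayley graph $X(S)$ has vertex set $G$ and $x,y$ adjacent iff $x^{-1}y\in S$; it is a connected $|S|$-regular simple graph. A connected $k$-regular graph is Ramanujan if $\mu\le 2\sqrt{k-1}$, where $\mu$ is the maximum of $|\lambda|$ over eigenvalues $\lambda$ of its adjacency matrix with $|\lambda|\ne k$. *)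

theory Defs
  imports
    "HOL-Algebra.Generated_Groups"
    "Jordan_Normal_Form.Spectral_Radius"
begin

section \<open>Frobenius groups\<close>

definition conj_set :: "('a, 'b) monoid_scheme \<Rightarrow> 'a set \<Rightarrow> 'a \<Rightarrow> 'a set" where
  "conj_set G H g = (\<lambda>h. inv\<^bsub>G\<^esub> g \<otimes>\<^bsub>G\<^esub> h \<otimes>\<^bsub>G\<^esub> g) ` H"

definition frobenius_group :: "('a, 'b) monoid_scheme \<Rightarrow> 'a set \<Rightarrow> bool" where
  "frobenius_group G H \<longleftrightarrow>
     group G \<and> finite (carrier G) \<and> subgroup H G \<and>
     H \<noteq> {\<one>\<^bsub>G\<^esub>} \<and> H \<noteq> carrier G \<and>
     (\<forall>g \<in> carrier G - H. H \<inter> conj_set G H g = {\<one>\<^bsub>G\<^esub>})"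

definition frobenius_kernel :: "('a, 'b) monoid_scheme \<Rightarrow> 'a set \<Rightarrow> 'a set" where
  "frobenius_kernel G H =
     (carrier G - (\<Union>g \<in> carrier G. conj_set G H g)) \<union> {\<one>\<^bsub>G\<^esub>}"

section \<open>Normal Cayley subsets\<close>

definition conj_class :: "('a, 'b) monoid_scheme \<Rightarrow> 'a \<Rightarrow> 'a set" where
  "conj_class G x = {inv\<^bsub>G\<^esub> g \<otimes>\<^bsub>G\<^esub> x \<otimes>\<^bsub>G\<^esub> g | g. g \<in> carrier G}"

definition union_of_conj_classes :: "('a, 'b) monoid_scheme \<Rightarrow> 'a set \<Rightarrow> bool" where
  "union_of_conj_classes G T \<longleftrightarrow> (\<exists>\<C> \<subseteq> conj_class G ` carrier G. T = \<Union>\<C>)"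

definition cayley_subset :: "('a, 'b) monoid_scheme \<Rightarrow> 'a set \<Rightarrow> bool" where
  "cayley_subset G S \<longleftrightarrow>
     S \<subseteq> carrier G - {\<one>\<^bsub>G\<^esub>} \<and> S = (\<lambda>x. inv\<^bsub>G\<^esub> x) ` S \<and> generate G S = carrier G"

definition normal_cayley_subsets :: "('a, 'b) monoid_scheme \<Rightarrow> 'a set set" where
  "normal_cayley_subsets G = {S. cayley_subset G S \<and> union_of_conj_classes G S}"

definition cayley_adj :: "('a, 'b) monoid_scheme \<Rightarrow> 'a set \<Rightarrow> 'a \<Rightarrow> 'a \<Rightarrow> bool" where
  "cayley_adj G S x y \<longleftrightarrow> inv\<^bsub>G\<^esub> x \<otimes>\<^bsub>G\<^esub> y \<in> S"

section \<open>Ramanujan graphs\<close>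

text \<open>A graph is given by a vertex set \<open>V\<close> and an adjacency relation \<open>E\<close>, of which only the
  restriction to \<open>V\<close> matters.\<close>

definition simple_graph :: "'v set \<Rightarrow> ('v \<Rightarrow> 'v \<Rightarrow> bool) \<Rightarrow> bool" where
  "simple_graph V E \<longleftrightarrow>
     finite V \<and> (\<forall>x\<in>V. \<not> E x x) \<and> (\<forall>x\<in>V. \<forall>y\<in>V. E x y \<longrightarrow> E y x)"

definition connected_graph :: "'v set \<Rightarrow> ('v \<Rightarrow> 'v \<Rightarrow> bool) \<Rightarrow> bool" where
  "connected_graph V E \<longleftrightarrow>
     V \<noteq> {} \<and> (\<forall>x\<in>V. \<forall>y\<in>V. (x, y) \<in> {(u, v). u \<in> V \<and> v \<in> V \<and> E u v}\<^sup>*)"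

definition regular_graph :: "'v set \<Rightarrow> ('v \<Rightarrow> 'v \<Rightarrow> bool) \<Rightarrow> nat \<Rightarrow> bool" where
  "regular_graph V E k \<longleftrightarrow> (\<forall>x\<in>V. card {y \<in> V. E x y} = k)"

text \<open>The rows and columns of the adjacency matrix follow an arbitrary enumeration of \<open>V\<close>; another
  enumeration gives a permutation-similar matrix with the same eigenvalues. The matrix is taken
  over the complex numbers so that \<open>eigenvalue\<close> misses no eigenvalue.\<close>

definition vertex_list :: "'v set \<Rightarrow> 'v list" where
  "vertex_list V = (SOME vs. set vs = V \<and> distinct vs)"

definition adjacency_matrix :: "'v set \<Rightarrow> ('v \<Rightarrow> 'v \<Rightarrow> bool) \<Rightarrow> complex mat" where
  "adjacency_matrix V E =
     mat (card V) (card V)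
       (\<lambda>(i, j). if E (vertex_list V ! i) (vertex_list V ! j) then 1 else 0)"

text \<open>Inserting 0 only matters when every eigenvalue has absolute value \<open>k\<close>; it makes the maximum
  over the empty set equal to 0.\<close>

definition graph_mu :: "'v set \<Rightarrow> ('v \<Rightarrow> 'v \<Rightarrow> bool) \<Rightarrow> nat \<Rightarrow> real" where
  "graph_mu V E k =
     Max (insert 0 {cmod z | z. eigenvalue (adjacency_matrix V E) z \<and> cmod z \<noteq> real k})"

definition ramanujan :: "'v set \<Rightarrow> ('v \<Rightarrow> 'v \<Rightarrow> bool) \<Rightarrow> bool" where
  "ramanujan V E \<longleftrightarrow>
     simple_graph V E \<and> connected_graph V E \<and>
     (\<exists>k. regular_graph V E k \<and> graph_mu V E k \<le> 2 * sqrt (real k - 1))"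

end

theory Submission
  imports Defs "HOL-Library.Function_Algebras"
begin

text \<open>
  Let \<open>N\<close> be the kernel, \<open>m = card N\<close>, \<open>h = card H\<close>, \<open>n = card G = m h\<close>, and
  let \<open>C\<close> be the complement of a normal Cayley subset \<open>S\<close>, of size \<open>l\<close>. An eigenvalue of \<open>X(S)\<close>
  other than \<open>card S\<close> is the negative of an eigenvalue of the Cayley graph of \<open>C\<close>, so its modulus is
  at most \<open>l\<close>, and \<open>l \<le> 2 \<surd>(card S - 1)\<close> is equivalent to \<open>l \<le> 2 (\<surd>n - 1)\<close>. A conjugacy class
  outside \<open>N\<close> has at least \<open>m\<close> elements, so \<open>l \<le> m\<close> forces \<open>C \<subseteq> N\<close>; then \<open>-l\<close> is an eigenvalue of
  \<open>X(S)\<close>, because \<open>N\<close> lies in a proper subgroup. Since \<open>r \<ge> 4\<close>, the bound \<open>2 (\<surd>n - 1)\<close> is below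
  \<open>m - 2\<close>, and the complement \<open>N\<close> (or, if \<open>h = 2\<close>, \<open>N\<close> without a pair \<open>x\<close>, \<open>x\<inverse>\<close>) shows that the
  Ramanujan property fails before \<open>l\<close> exceeds \<open>m\<close>.

  That \<open>N\<close> lies in a proper subgroup is the only part of Frobenius' theorem that is needed. It is
  proved in the group algebra with idempotents in place of representations. For a minimal
  self-adjoint idempotent \<open>e\<close> of the algebra of \<open>H\<close> orthogonal to the trivial one \<open>e\<^sub>H\<close>, put
  \<open>E = e - d e\<^sub>H + d e\<^sub>G\<close> with \<open>d = h e(1)\<close>, and let \<open>\<psi>\<close> be the sum of the conjugates of \<open>E\<close>. This is
  a virtual character of norm 1 with value \<open>d\<close> on \<open>N\<close>. Integrality of traces of idempotents forces
  \<open>\<psi>\<close> to be a multiple of a single central idempotent, and equality in Cauchy-Schwarz then shows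
  that \<open>\<psi>\<close> is invariant under translation by \<open>N\<close>; its stabiliser is the proper subgroup.
\<close>

section \<open>Linear algebra over finite index sets\<close>

lemma sum_in_Nats:
  assumes "\<And>i. i \<in> I \<Longrightarrow> f i \<in> \<nat>"
  shows "sum f I \<in> (\<nat> :: 'a :: semiring_1 set)"
  using assms by (induction I rule: infinite_finite_induct) auto

text \<open>Schur triangularisation turns \<open>A\<close> into an upper triangular idempotent
  \<open>B\<close>, whose diagonal entries satisfy b^2 = b and so are 0 or 1. The trace is invariant
  under similarity.\<close>

lemma idempotent_mat_diag_sum_Nats:
  fixes A :: "complex mat"
  assumes A: "A \<in> carrier_mat n n" and idem: "A * A = A"
  shows "(\<Sum>i<n. A $$ (i, i)) \<in> \<nat>"
proof -
  obtain es where es: "char_poly A = (\<Prod>e\<leftarrow>es. [:- e, 1:])"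
    using char_poly_factorized[OF A] by blast
  obtain B P Q where "schur_decomposition A es = (B, P, Q)"
    by (cases "schur_decomposition A es") auto
  from schur_decomposition[OF A es this]
  have sim: "similar_mat_wit A B P Q" and ut: "upper_triangular B"
    by auto
  note * = similar_mat_witD2[OF A sim]
  have carr: "B \<in> carrier_mat n n" "P \<in> carrier_mat n n" "Q \<in> carrier_mat n n"
    and PQ: "P * Q = 1\<^sub>m n" "Q * P = 1\<^sub>m n" and APBQ: "A = P * B * Q"
    using * by auto
  have "Q * A * P = (Q * P) * B * (Q * P)"
    unfolding APBQ using carr A by (simp add: assoc_mult_mat[of _ n n _ n _ n])
  then have B: "B = Q * A * P" using PQ carr by simp
  have "B * B = Q * (A * ((P * Q) * (A * P)))"
    unfolding B using carr A by (simp add: assoc_mult_mat[of _ n n _ n _ n])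
  also have "\<dots> = Q * ((A * A) * P)"
    unfolding PQ using carr A by (simp add: assoc_mult_mat[of _ n n _ n _ n])
  also have "\<dots> = B"
    unfolding idem B using carr A by (simp add: assoc_mult_mat[of _ n n _ n _ n])
  finally have BB: "B * B = B" .
  have diag: "B $$ (i, i) = 0 \<or> B $$ (i, i) = 1" if i: "i < n" for i
  proof -
    have "B $$ (i, i) = (\<Sum>k<n. B $$ (i, k) * B $$ (k, i))"
      using arg_cong[OF BB, of "\<lambda>M. M $$ (i, i)"] i carr
      by (simp add: scalar_prod_def atLeast0LessThan)
    also have "\<dots> = (\<Sum>k\<in>{i}. B $$ (i, k) * B $$ (k, i))"
    proof (rule sum.mono_neutral_right)
      show "\<forall>k\<in>{..<n} - {i}. B $$ (i, k) * B $$ (k, i) = 0"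
      proof
        fix k assume "k \<in> {..<n} - {i}"
        then consider "k < i" | "i < k" "k < n" by fastforce
        then show "B $$ (i, k) * B $$ (k, i) = 0"
          using ut i carr by cases (auto simp: upper_triangular_def)
      qed
    qed (use i in auto)
    finally have "B $$ (i, i) * (B $$ (i, i) - 1) = 0" by (simp add: algebra_simps)
    then show ?thesis by simp
  qed
  define R where "R = B * Q"
  have R: "R \<in> carrier_mat n n" using carr by (simp add: R_def)
  have "(\<Sum>i<n. A $$ (i, i)) = (\<Sum>i<n. \<Sum>k<n. P $$ (i, k) * R $$ (k, i))"
  proof (rule sum.cong)
    fix i assume "i \<in> {..<n}"
    moreover have "A = P * R" using APBQ carr unfolding R_def by (simp add: assoc_mult_mat[of _ n n _ n _ n])
    ultimately show "A $$ (i, i) = (\<Sum>k<n. P $$ (i, k) * R $$ (k, i))"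
      using carr R by (simp add: scalar_prod_def atLeast0LessThan)
  qed simp
  also have "\<dots> = (\<Sum>k<n. \<Sum>i<n. R $$ (k, i) * P $$ (i, k))"
    by (subst sum.swap) (simp add: mult.commute)
  also have "\<dots> = (\<Sum>k<n. B $$ (k, k))"
  proof (rule sum.cong)
    fix k assume k: "k \<in> {..<n}"
    have "B = R * P" using PQ carr unfolding R_def by (simp add: assoc_mult_mat[of _ n n _ n _ n])
    from arg_cong[OF this, of "\<lambda>M. M $$ (k, k)"]
    show "(\<Sum>i<n. R $$ (k, i) * P $$ (i, k)) = B $$ (k, k)"
      using k carr R by (simp add: scalar_prod_def atLeast0LessThan)
  qed simp
  also have "\<dots> \<in> \<nat>"
  proof (rule sum_in_Nats)
    fix k assume "k \<in> {..<n}"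
    then show "B $$ (k, k) \<in> \<nat>" using diag[of k] by auto
  qed
  finally show ?thesis .
qed

text \<open>Transport to an arbitrary finite index set, so that operators on functions on a group or
  a subgroup can be used without enumerating it.\<close>

lemma idempotent_kernel_trace_Nats:
  fixes K :: "'a \<Rightarrow> 'a \<Rightarrow> complex"
  assumes fin: "finite I"
    and idem: "\<And>i k. i \<in> I \<Longrightarrow> k \<in> I \<Longrightarrow> (\<Sum>j\<in>I. K i j * K j k) = K i k"
  shows "(\<Sum>i\<in>I. K i i) \<in> \<nat>"
proof -
  obtain f where f: "bij_betw f {..<card I} I"
    using ex_bij_betw_nat_finite[OF fin] by (auto simp: atLeast0LessThan)
  define A where "A = mat (card I) (card I) (\<lambda>(i, j). K (f i) (f j))"
  have A: "A \<in> carrier_mat (card I) (card I)" by (simp add: A_def)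
  have mem: "f i \<in> I" if "i < card I" for i using f that by (auto dest: bij_betwE)
  have "A * A = A"
  proof (rule eq_matI)
    fix i k assume "i < dim_row A" "k < dim_col A"
    then have ik: "i < card I" "k < card I" by (auto simp: A_def)
    have "(A * A) $$ (i, k) = (\<Sum>j<card I. K (f i) (f j) * K (f j) (f k))"
      using ik by (simp add: A_def scalar_prod_def atLeast0LessThan)
    also have "\<dots> = (\<Sum>j\<in>I. K (f i) j * K j (f k))"
      by (rule sum.reindex_bij_betw[OF f])
    finally show "(A * A) $$ (i, k) = A $$ (i, k)"
      using ik idem mem by (simp add: A_def)
  qed (auto simp: A_def)
  from idempotent_mat_diag_sum_Nats[OF A this]
  have "(\<Sum>i<card I. K (f i) (f i)) \<in> \<nat>" by (simp add: A_def)
  then show ?thesis using sum.reindex_bij_betw[OF f, of "\<lambda>i. K i i"] by simp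
qed

lemma exists_linear_relation:
  fixes v :: "nat \<Rightarrow> 'a \<Rightarrow> complex"
  assumes fin: "finite I"
  shows "\<exists>c. (\<exists>i\<le>card I. c i \<noteq> 0) \<and> (\<forall>x\<in>I. (\<Sum>i\<le>card I. c i * v i x) = 0)"
proof -
  let ?n = "card I"
  obtain f where f: "bij_betw f {..<?n} I"
    using ex_bij_betw_nat_finite[OF fin] by (auto simp: atLeast0LessThan)
  \<comment> \<open>There is one more vector than there are coordinates; a zero row makes the matrix
    square and singular, and a kernel vector supplies the coefficients.\<close>
  define A where "A = mat (Suc ?n) (Suc ?n) (\<lambda>(j, i). if j < ?n then v i (f j) else 0)"
  have A: "A \<in> carrier_mat (Suc ?n) (Suc ?n)" by (simp add: A_def)
  have "det A = det (mat\<^sub>r (Suc ?n) (Suc ?n) (\<lambda>j. if j = ?n then 0\<^sub>v (Suc ?n) else row A j))"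
    by (rule arg_cong[of _ _ det], rule eq_matI) (auto simp: A_def)
  also have "\<dots> = 0" by (rule det_row_0) (auto simp: A_def)
  finally obtain w where w: "w \<in> carrier_vec (Suc ?n)" "w \<noteq> 0\<^sub>v (Suc ?n)"
    "A *\<^sub>v w = 0\<^sub>v (Suc ?n)"
    using det_0_iff_vec_prod_zero[OF A] by blast
  show ?thesis
  proof (intro exI[of _ "\<lambda>i. w $ i"] conjI ballI)
    show "\<exists>i\<le>?n. w $ i \<noteq> 0"
    proof (rule ccontr)
      assume "\<not> ?thesis"
      then have "w = 0\<^sub>v (Suc ?n)" using w(1) by (intro eq_vecI) auto
      with w(2) show False by simp
    qed
    fix x assume "x \<in> I"
    then obtain j where j: "j < ?n" "x = f j" using f by (auto simp: bij_betw_def)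
    have "0 = (A *\<^sub>v w) $ j" using w(3) j by simp
    also have "\<dots> = (\<Sum>i<Suc ?n. v i (f j) * w $ i)"
      using j w(1) by (simp add: A_def scalar_prod_def atLeast0LessThan)
    finally show "(\<Sum>i\<le>?n. w $ i * v i x) = 0"
      using j by (simp add: lessThan_Suc_atMost mult.commute)
  qed
qed

section \<open>The group algebra\<close>

definition smul :: "complex \<Rightarrow> ('a \<Rightarrow> complex) \<Rightarrow> 'a \<Rightarrow> complex" (infixr "\<odot>" 75) where
  "c \<odot> f = (\<lambda>x. c * f x)"

definition supported :: "'a set \<Rightarrow> ('a \<Rightarrow> complex) \<Rightarrow> bool" where
  "supported K f \<longleftrightarrow> (\<forall>x. x \<notin> K \<longrightarrow> f x = 0)"

definition delta :: "'a \<Rightarrow> 'a \<Rightarrow> complex" where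
  "delta x = (\<lambda>y. if y = x then 1 else 0)"

lemma smul_apply [simp]: "(c \<odot> f) x = c * f x"
  by (simp add: smul_def)

lemma smul_smul [simp]: "c \<odot> (c' \<odot> f) = (c * c') \<odot> f"
  by (auto simp: fun_eq_iff)

lemma smul_one [simp]: "1 \<odot> f = f"
  by (auto simp: fun_eq_iff)

lemma smul_zero [simp]: "0 \<odot> f = 0" "c \<odot> 0 = 0"
  by (auto simp: fun_eq_iff)

lemma smul_eq_0_iff: "c \<odot> f = 0 \<longleftrightarrow> c = 0 \<or> f = 0"
  by (auto simp: fun_eq_iff)

lemma supportedD: "supported K f \<Longrightarrow> x \<notin> K \<Longrightarrow> f x = 0"
  by (simp add: supported_def)

lemma supported_subset: "supported K f \<Longrightarrow> K \<subseteq> K' \<Longrightarrow> supported K' f"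
  by (auto simp: supported_def)

lemma supported_smul: "supported K f \<Longrightarrow> supported K (c \<odot> f)"
  by (simp add: supported_def)

lemma supported_add: "supported K f \<Longrightarrow> supported K g \<Longrightarrow> supported K (f + g)"
  by (simp add: supported_def)

locale finite_group = group G for G (structure) +
  assumes fin: "finite (carrier G)"
begin

text \<open>Elements of the group algebra are functions that vanish outside the carrier; forcing
  products to do so lets identities hold as equalities of functions.\<close>

definition conv :: "('a \<Rightarrow> complex) \<Rightarrow> ('a \<Rightarrow> complex) \<Rightarrow> 'a \<Rightarrow> complex" (infixl "\<star>" 70) where
  "f \<star> g = (\<lambda>x. if x \<in> carrier G then \<Sum>y\<in>carrier G. f y * g (inv y \<otimes> x) else 0)"

text \<open>Left convolution by \<open>adj f\<close> is the adjoint, for the l2 inner product, of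
  left convolution by \<open>f\<close>.\<close>

definition adj :: "('a \<Rightarrow> complex) \<Rightarrow> 'a \<Rightarrow> complex" where
  "adj f = (\<lambda>x. if x \<in> carrier G then cnj (f (inv x)) else 0)"

text \<open>This replaces characters: for an idempotent \<open>f\<close>, the value of
  \<open>chi f\<close> at \<open>inv g\<close> is the trace of \<open>g\<close> on the left ideal
  generated by \<open>f\<close>. For \<open>f\<close> in the algebra of a subgroup it is an induced
  character.\<close>

definition chi :: "('a \<Rightarrow> complex) \<Rightarrow> 'a \<Rightarrow> complex" where
  "chi f = (\<lambda>x. if x \<in> carrier G then \<Sum>y\<in>carrier G. f (inv y \<otimes> x \<otimes> y) else 0)"

lemma sum_translate_left:
  assumes "z \<in> carrier G"
  shows "(\<Sum>y\<in>carrier G. F (z \<otimes> y)) = (\<Sum>y\<in>carrier G. F y)"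
  using assms
  by (intro sum.reindex_bij_witness[of _ "\<lambda>y. inv z \<otimes> y" "\<lambda>y. z \<otimes> y"])
    (auto simp: m_assoc[symmetric])

lemma sum_translate_right:
  assumes "z \<in> carrier G"
  shows "(\<Sum>y\<in>carrier G. F (y \<otimes> z)) = (\<Sum>y\<in>carrier G. F y)"
  using assms
  by (intro sum.reindex_bij_witness[of _ "\<lambda>y. y \<otimes> inv z" "\<lambda>y. y \<otimes> z"])
    (auto simp: m_assoc)

lemma sum_invert: "(\<Sum>y\<in>carrier G. F (inv y)) = (\<Sum>y\<in>carrier G. F y)"
  by (intro sum.reindex_bij_witness[of _ "\<lambda>y. inv y" "\<lambda>y. inv y"]) auto

lemma conv_assoc: "(f \<star> g) \<star> k = f \<star> (g \<star> k)"
proof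
  fix x
  show "((f \<star> g) \<star> k) x = (f \<star> (g \<star> k)) x"
  proof (cases "x \<in> carrier G")
    case True
    have "((f \<star> g) \<star> k) x
        = (\<Sum>y\<in>carrier G. \<Sum>z\<in>carrier G. f z * (g (inv z \<otimes> y) * k (inv y \<otimes> x)))"
      using True by (simp add: conv_def sum_distrib_right mult.assoc)
    also have "\<dots> = (\<Sum>z\<in>carrier G. \<Sum>y\<in>carrier G. f z * (g (inv z \<otimes> y) * k (inv y \<otimes> x)))"
      by (rule sum.swap)
    also have "\<dots> = (\<Sum>z\<in>carrier G. \<Sum>y\<in>carrier G.
        f z * (g (inv z \<otimes> (z \<otimes> y)) * k (inv (z \<otimes> y) \<otimes> x)))"
      by (rule sum.cong[OF refl],
          rule sum_translate_left[where F = "\<lambda>y. f _ * (g (inv _ \<otimes> y) * k (inv y \<otimes> x))", symmetric])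
    also have "\<dots> = (f \<star> (g \<star> k)) x"
      using True by (simp add: conv_def sum_distrib_left m_assoc[symmetric] inv_mult_group)
    finally show ?thesis .
  qed (simp add: conv_def)
qed

lemma conv_add_left: "(f + g) \<star> k = f \<star> k + g \<star> k"
  by (auto simp: fun_eq_iff conv_def sum.distrib algebra_simps)

lemma conv_add_right: "k \<star> (f + g) = k \<star> f + k \<star> g"
  by (auto simp: fun_eq_iff conv_def sum.distrib algebra_simps)

lemma conv_smul_left: "(c \<odot> f) \<star> g = c \<odot> (f \<star> g)"
  by (auto simp: fun_eq_iff conv_def sum_distrib_left algebra_simps)

lemma conv_smul_right: "f \<star> (c \<odot> g) = c \<odot> (f \<star> g)"
  by (auto simp: fun_eq_iff conv_def sum_distrib_left algebra_simps)

lemma conv_zero [simp]: "0 \<star> f = 0" "f \<star> 0 = 0"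
  by (auto simp: fun_eq_iff conv_def)

lemma supported_conv_carrier: "supported (carrier G) (f \<star> g)"
  by (simp add: supported_def conv_def)

lemma delta_one_conv:
  assumes "supported (carrier G) f"
  shows "delta \<one> \<star> f = f"
proof
  fix x
  have "(\<Sum>y\<in>carrier G. delta \<one> y * f (inv y \<otimes> x)) = (\<Sum>y\<in>{\<one>}. delta \<one> y * f (inv y \<otimes> x))"
    by (rule sum.mono_neutral_right) (auto simp: fin delta_def)
  then show "(delta \<one> \<star> f) x = f x"
    using supportedD[OF assms, of x] by (auto simp: conv_def delta_def)
qed

lemma conv_delta_one:
  assumes "supported (carrier G) f"
  shows "f \<star> delta \<one> = f"
proof
  fix x
  show "(f \<star> delta \<one>) x = f x"
  proof (cases "x \<in> carrier G")
    case True
    have "(\<Sum>y\<in>carrier G. f y * delta \<one> (inv y \<otimes> x)) = (\<Sum>y\<in>{x}. f y * delta \<one> (inv y \<otimes> x))"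
    proof (rule sum.mono_neutral_right)
      show "\<forall>y\<in>carrier G - {x}. f y * delta \<one> (inv y \<otimes> x) = 0"
      proof
        fix y assume y: "y \<in> carrier G - {x}"
        have "inv y \<otimes> x \<noteq> \<one>"
        proof
          assume "inv y \<otimes> x = \<one>"
          then have "y \<otimes> (inv y \<otimes> x) = y" using y by simp
          then show False using y True by (simp add: m_assoc[symmetric])
        qed
        then show "f y * delta \<one> (inv y \<otimes> x) = 0" by (simp add: delta_def)
      qed
    qed (use True fin in auto)
    then show ?thesis using True by (simp add: conv_def delta_def)
  qed (use supportedD[OF assms, of x] in \<open>auto simp: conv_def\<close>)
qed

lemma conv_at_one: "(f \<star> g) \<one> = (\<Sum>y\<in>carrier G. f y * g (inv y))"
  by (simp add: conv_def)

lemma conv_at_one_commute: "(f \<star> g) \<one> = (g \<star> f) \<one>"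
proof -
  have "(f \<star> g) \<one> = (\<Sum>y\<in>carrier G. f (inv y) * g (inv (inv y)))"
    unfolding conv_at_one by (rule sum_invert[symmetric])
  then show ?thesis by (simp add: conv_at_one mult.commute)
qed

lemma supported_conv:
  assumes K: "subgroup K G" and f: "supported K f" and g: "supported K g"
  shows "supported K (f \<star> g)"
  unfolding supported_def
proof (intro allI impI)
  fix x assume x: "x \<notin> K"
  have "f y * g (inv y \<otimes> x) = 0" if y: "y \<in> carrier G" and xG: "x \<in> carrier G" for y
  proof (cases "y \<in> K")
    case True
    have "inv y \<otimes> x \<notin> K"
    proof
      assume "inv y \<otimes> x \<in> K"
      then have "y \<otimes> (inv y \<otimes> x) \<in> K" using subgroup.m_closed[OF K True] by blast
      then show False using x y xG by (simp add: m_assoc[symmetric])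
    qed
    then show ?thesis using supportedD[OF g] by simp
  qed (use supportedD[OF f] in simp)
  then show "(f \<star> g) x = 0" by (simp add: conv_def)
qed

lemma supported_adj:
  assumes "subgroup K G" and "supported K f"
  shows "supported K (adj f)"
  unfolding supported_def
proof (intro allI impI)
  fix x assume "x \<notin> K"
  then have "x \<in> carrier G \<Longrightarrow> inv x \<notin> K"
    using subgroup.m_inv_closed[OF assms(1), of "inv x"] by auto
  then show "adj f x = 0" using supportedD[OF assms(2)] by (auto simp: adj_def)
qed

lemma adj_adj: "supported (carrier G) f \<Longrightarrow> adj (adj f) = f"
  by (auto simp: fun_eq_iff adj_def supported_def)

lemma adj_add: "adj (f + g) = adj f + adj g"
  by (auto simp: fun_eq_iff adj_def)

lemma adj_smul: "adj (c \<odot> f) = cnj c \<odot> adj f"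
  by (auto simp: fun_eq_iff adj_def)

lemma adj_zero [simp]: "adj 0 = 0"
  by (auto simp: fun_eq_iff adj_def)

lemma adj_delta_one: "adj (delta \<one>) = delta \<one>"
  by (auto simp: fun_eq_iff adj_def delta_def)

lemma adj_conv: "adj (f \<star> g) = adj g \<star> adj f"
proof
  fix x
  show "adj (f \<star> g) x = (adj g \<star> adj f) x"
  proof (cases "x \<in> carrier G")
    case True
    have "adj (f \<star> g) x = (\<Sum>y\<in>carrier G. cnj (f y) * cnj (g (inv y \<otimes> inv x)))"
      using True by (simp add: adj_def conv_def)
    also have "\<dots> = (\<Sum>y\<in>carrier G. cnj (f (inv x \<otimes> y)) * cnj (g (inv (inv x \<otimes> y) \<otimes> inv x)))"
      using True
        sum_translate_left[of "inv x" "\<lambda>y. cnj (f y) * cnj (g (inv y \<otimes> inv x))"] by simp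
    also have "\<dots> = (adj g \<star> adj f) x"
      using True unfolding adj_def conv_def
      by (auto intro!: sum.cong simp: inv_mult_group m_assoc mult.commute)
    finally show ?thesis .
  qed (simp add: conv_def adj_def)
qed

text \<open>Positivity of this value takes the role of semisimplicity:
  \<open>adj f \<star> f\<close> is nonzero for nonzero \<open>f\<close>, so a nonzero self-adjoint
  element cannot be nilpotent.\<close>

lemma adj_conv_self_at_one:
  "(adj f \<star> f) \<one> = of_real (\<Sum>y\<in>carrier G. (cmod (f y))\<^sup>2)"
proof -
  have "(adj f \<star> f) \<one> = (\<Sum>y\<in>carrier G. of_real ((cmod (f (inv y)))\<^sup>2))"
    unfolding conv_at_one
    by (intro sum.cong) (auto simp: adj_def complex_norm_square mult.commute simp del: of_real_power)
  also have "\<dots> = (\<Sum>y\<in>carrier G. of_real ((cmod (f y))\<^sup>2))"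
    by (rule sum_invert)
  finally show ?thesis by simp
qed

lemma adj_conv_self_pos:
  assumes "supported (carrier G) f" "f \<noteq> 0"
  shows "\<exists>t::real. t > 0 \<and> (adj f \<star> f) \<one> = of_real t"
proof -
  from assms obtain y where "y \<in> carrier G" "f y \<noteq> 0"
    by (auto simp: fun_eq_iff supported_def)
  then have "(\<Sum>y\<in>carrier G. (cmod (f y))\<^sup>2) > 0"
    by (intro sum_pos2[of _ y]) (auto simp: fin)
  then show ?thesis unfolding adj_conv_self_at_one by blast
qed

lemma adj_conv_self_nonzero:
  assumes "supported (carrier G) f" "f \<noteq> 0"
  shows "adj f \<star> f \<noteq> 0"
  using adj_conv_self_pos[OF assms] by (metis less_irrefl of_real_eq_0_iff zero_fun_apply)

end

section \<open>Eigenvectors and idempotents in the algebra generated by one element\<close>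

lemma sum_coeff_linear_factor:
  fixes v :: "nat \<Rightarrow> complex"
  shows "(\<Sum>i\<le>degree ([:- c, 1:] * q). coeff ([:- c, 1:] * q) i * v i)
    = (\<Sum>i\<le>degree q. coeff q i * (v (Suc i) - c * v i))"
proof -
  have ext: "(\<Sum>i\<le>degree p. coeff p i * w i) = (\<Sum>i\<le>n. coeff p i * w i)"
    if "degree p \<le> n" for p :: "complex poly" and w n
    using that by (intro sum.mono_neutral_left) (auto simp: coeff_eq_0)
  have "degree ([:- c, 1:] * q) \<le> Suc (degree q)"
    using degree_mult_le[of "[:- c, 1:]" q] by simp
  then have "(\<Sum>i\<le>degree ([:- c, 1:] * q). coeff ([:- c, 1:] * q) i * v i)
      = (\<Sum>i\<le>Suc (degree q). coeff ([:- c, 1:] * q) i * v i)" by (rule ext)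
  also have "\<dots> = (\<Sum>i\<le>Suc (degree q). coeff (pCons 0 q) i * v i)
      - c * (\<Sum>i\<le>Suc (degree q). coeff q i * v i)"
    by (simp add: sum_subtractf sum_distrib_left algebra_simps sum.distrib sum_negf)
  also have "(\<Sum>i\<le>Suc (degree q). coeff (pCons 0 q) i * v i) = (\<Sum>i\<le>degree q. coeff q i * v (Suc i))"
    by (subst sum.atMost_Suc_shift) simp
  also have "(\<Sum>i\<le>Suc (degree q). coeff q i * v i) = (\<Sum>i\<le>degree q. coeff q i * v i)"
    by (rule ext[symmetric]) simp
  finally show ?thesis
    by (simp add: sum_subtractf sum_distrib_left algebra_simps)
qed

context finite_group
begin

text \<open>These are the polynomials in \<open>a\<close> without constant term. The missing
  constant term is what lets a factor \<open>l\<close> split off in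
  \<open>palg_adj_eigenvector\<close>.\<close>

inductive_set palg :: "('a \<Rightarrow> complex) \<Rightarrow> ('a \<Rightarrow> complex) set" for a where
  gen: "a \<in> palg a"
| add: "f \<in> palg a \<Longrightarrow> g \<in> palg a \<Longrightarrow> f + g \<in> palg a"
| smul: "f \<in> palg a \<Longrightarrow> c \<odot> f \<in> palg a"
| conv: "f \<in> palg a \<Longrightarrow> a \<star> f \<in> palg a"

lemma palg_commute:
  assumes "f \<in> palg a" and "g \<star> a = a \<star> g"
  shows "g \<star> f = f \<star> g"
  using assms
proof (induction rule: palg.induct)
  case (conv f)
  then show ?case by (metis conv_assoc)
qed (auto simp: conv_add_left conv_add_right conv_smul_left conv_smul_right)

lemma palg_supported:
  assumes "f \<in> palg a" and "subgroup K G" and "supported K a"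
  shows "supported K f"
  using assms
  by (induction rule: palg.induct) (auto intro: supported_add supported_smul supported_conv)

lemma palg_eigenvector:
  assumes "f \<in> palg a" and "a \<star> b = l \<odot> b"
  shows "\<exists>k. f \<star> b = k \<odot> b"
  using assms
proof (induction rule: palg.induct)
  case (add f g)
  then obtain k k' where "f \<star> b = k \<odot> b" "g \<star> b = k' \<odot> b" by blast
  then have "(f + g) \<star> b = (k + k') \<odot> b" by (simp add: conv_add_left fun_eq_iff algebra_simps)
  then show ?case by blast
next
  case (conv f)
  then obtain k where "f \<star> b = k \<odot> b" by blast
  then have "(a \<star> f) \<star> b = (k * l) \<odot> b" by (simp only: conv_assoc conv_smul_right conv.prems smul_smul mult.commute)
  then show ?case by blast
qed (auto simp: conv_smul_left)

text \<open>The factor \<open>l\<close> is kept visible because it later yields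
  \<open>l \<noteq> 0\<close>: the nonzero element \<open>adj b \<star> b\<close> is a multiple of
  it.\<close>

lemma palg_adj_eigenvector:
  assumes "f \<in> palg a" and "a \<star> b = l \<odot> b" and "adj a = a"
  shows "\<exists>k. adj f \<star> b = (k * l) \<odot> b"
  using assms
proof (induction rule: palg.induct)
  case gen
  then show ?case by (metis mult_1)
next
  case (add f g)
  then obtain k k' where "adj f \<star> b = (k * l) \<odot> b" "adj g \<star> b = (k' * l) \<odot> b" by blast
  then have "adj (f + g) \<star> b = ((k + k') * l) \<odot> b"
    by (simp add: adj_add conv_add_left fun_eq_iff algebra_simps)
  then show ?case by blast
next
  case (smul f c)
  then obtain k where "adj f \<star> b = (k * l) \<odot> b" by blast
  then have "adj (c \<odot> f) \<star> b = ((cnj c * k) * l) \<odot> b"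
    by (simp add: adj_smul conv_smul_left algebra_simps)
  then show ?case by blast
next
  case (conv f)
  then obtain k where "adj f \<star> b = (k * l) \<odot> b" by blast
  then have "adj (a \<star> f) \<star> b = ((k * l) * l) \<odot> b"
    by (simp only: adj_conv conv_assoc conv_smul_right conv.prems smul_smul mult.commute)
  then show ?case by blast
qed

lemma conv_funpow_shift:
  "((\<star>) a ^^ i) (a \<star> b + (- c) \<odot> b) = ((\<star>) a ^^ Suc i) b + (- c) \<odot> ((\<star>) a ^^ i) b"
  by (induction i) (simp_all only: funpow.simps comp_apply id_apply conv_add_right conv_smul_right)

text \<open>Induction on the degree of the annihilating polynomial. If \<open>l\<close> is a root of
  \<open>q\<close>, then either \<open>b\<close> is an eigenvector for \<open>l\<close>, or
  \<open>a \<star> b + (- l) \<odot> b\<close> is a nonzero element killed by the quotient of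
  \<open>q\<close> by X - \<open>l\<close>.\<close>

lemma palg_eigenvector_of_annihilator:
  assumes "q \<noteq> 0" "b \<in> palg a" "b \<noteq> 0"
    and "\<And>x. (\<Sum>i\<le>degree q. coeff q i * ((\<star>) a ^^ i) b x) = 0"
  shows "\<exists>b'\<in>palg a. \<exists>l. b' \<noteq> 0 \<and> a \<star> b' = l \<odot> b'"
  using assms
proof (induction "degree q" arbitrary: q b)
  case 0
  then obtain c where c: "q = [:c:]" by (metis degree_eq_zeroE)
  with 0 have "b = 0" by (auto simp: fun_eq_iff)
  with 0 show ?case by simp
next
  case (Suc n)
  have "\<not> constant (poly q)" using Suc(2) by (simp add: constant_degree)
  then obtain l where "poly q l = 0" using fundamental_theorem_of_algebra by blast
  then obtain q1 where q1: "q = [:- l, 1:] * q1" by (auto simp: poly_eq_0_iff_dvd)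
  have q1n: "q1 \<noteq> 0" using q1 Suc.prems by auto
  have "degree q = Suc (degree q1)"
    unfolding q1 using q1n by (subst degree_mult_eq) auto
  with Suc(2) have deg: "degree q1 = n" by simp
  let ?b = "a \<star> b + (- l) \<odot> b"
  show ?case
  proof (cases "?b = 0")
    case True
    then have "a \<star> b = l \<odot> b" by (auto simp: fun_eq_iff)
    with Suc.prems show ?thesis by blast
  next
    case False
    have "(\<Sum>i\<le>degree q1. coeff q1 i * ((\<star>) a ^^ i) ?b x) = 0" for x
      using Suc.prems(4)[of x] unfolding q1 sum_coeff_linear_factor conv_funpow_shift by simp
    moreover have "?b \<in> palg a" using Suc.prems by (intro palg.intros)
    ultimately show ?thesis using Suc.hyps(1)[of q1 ?b] deg q1n False by auto
  qed
qed

text \<open>The powers of \<open>a\<close> with exponents from 1 to card G + 1 are linearly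
  dependent, and the coefficients of a relation form the polynomial needed above, with
  \<open>a\<close> itself as starting vector.\<close>

lemma palg_eigenvector_exists:
  assumes "a \<noteq> 0" and "supported (carrier G) a"
  shows "\<exists>b\<in>palg a. \<exists>l. b \<noteq> 0 \<and> a \<star> b = l \<odot> b"
proof -
  let ?n = "card (carrier G)"
  obtain c where c: "\<exists>i\<le>?n. c i \<noteq> 0"
    "\<And>x. x \<in> carrier G \<Longrightarrow> (\<Sum>i\<le>?n. c i * ((\<star>) a ^^ i) a x) = 0"
    using exists_linear_relation[OF fin, of "\<lambda>i. ((\<star>) a ^^ i) a"] by blast
  define q where "q = Poly (map c [0..<Suc ?n])"
  have coeff: "coeff q i = (if i \<le> ?n then c i else 0)" for i
    by (auto simp: q_def nth_default_def simp del: upt_Suc)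
  have q: "q \<noteq> 0" using c(1) coeff by (metis coeff_0)
  have deg: "degree q \<le> ?n" by (rule degree_le) (simp add: coeff)
  have supp: "supported (carrier G) (((\<star>) a ^^ i) a)" for i
    using assms(2) supported_conv_carrier by (cases i) auto
  have "(\<Sum>i\<le>degree q. coeff q i * ((\<star>) a ^^ i) a x) = 0" for x
  proof (cases "x \<in> carrier G")
    case True
    have "(\<Sum>i\<le>degree q. coeff q i * ((\<star>) a ^^ i) a x) = (\<Sum>i\<le>?n. coeff q i * ((\<star>) a ^^ i) a x)"
      using deg by (intro sum.mono_neutral_left) (auto simp: coeff_eq_0)
    also have "\<dots> = 0" using c(2)[OF True] by (simp add: coeff)
    finally show ?thesis .
  qed (use supportedD[OF supp] in simp)
  from palg_eigenvector_of_annihilator[OF q palg.gen assms(1) this]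
  show ?thesis .
qed

text \<open>For an eigenvector \<open>b\<close> of \<open>a\<close> in \<open>palg a\<close>, both
  \<open>adj b \<star> b\<close> and \<open>b \<star> b\<close> are multiples of \<open>b\<close>.
  Hence \<open>s = adj b \<star> b\<close> is self-adjoint with
  \<open>s \<star> s = m \<odot> s\<close>, and \<open>p\<close> is \<open>s\<close> divided by
  \<open>m\<close>. As a multiple of \<open>b\<close>, it inherits commutation and support from
  \<open>a\<close>.\<close>

lemma spectral_idempotent:
  assumes a0: "a \<noteq> 0" and supp: "supported (carrier G) a" and sa: "adj a = a"
  obtains l p where "l \<noteq> 0" "p \<noteq> 0" "adj p = p" "p \<star> p = p" "a \<star> p = l \<odot> p"
    "\<And>g. g \<star> a = a \<star> g \<Longrightarrow> g \<star> p = p \<star> g"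
    "\<And>K. subgroup K G \<Longrightarrow> supported K a \<Longrightarrow> supported K p"
proof -
  obtain b l where b: "b \<in> palg a" "b \<noteq> 0" "a \<star> b = l \<odot> b"
    using palg_eigenvector_exists[OF a0 supp] by blast
  have bs: "supported (carrier G) b" by (rule palg_supported[OF b(1) subgroup_self supp])
  define s where "s = adj b \<star> b"
  have s0: "s \<noteq> 0" unfolding s_def by (rule adj_conv_self_nonzero[OF bs b(2)])
  have ss: "supported (carrier G) s" unfolding s_def by (rule supported_conv_carrier)
  have sadj: "adj s = s" unfolding s_def by (simp add: adj_conv adj_adj[OF bs])
  obtain k where k: "s = (k * l) \<odot> b"
    using palg_adj_eigenvector[OF b(1,3) sa] unfolding s_def by blast
  with s0 have l0: "l \<noteq> 0" by auto
  obtain k' where k': "b \<star> b = k' \<odot> b" using palg_eigenvector[OF b(1,3)] by blast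
  define m where "m = k * l * k'"
  have sq: "s \<star> s = m \<odot> s"
    unfolding m_def k by (simp add: conv_smul_left conv_smul_right k' algebra_simps)
  obtain t1 t2 :: real where t: "t1 > 0" "(adj s \<star> s) \<one> = of_real t1" "t2 > 0" "s \<one> = of_real t2"
    using adj_conv_self_pos[OF ss s0] adj_conv_self_pos[OF bs b(2)] unfolding s_def[symmetric] by blast
  \<comment> \<open>Evaluation at \<open>\<one>\<close> compares two squared norms, so
    \<open>m\<close> is a positive real; the division is possible and keeps the quotient
    self-adjoint.\<close>
  have "m * of_real t2 = of_real t1"
    using t(2,4) unfolding sadj sq by simp
  then have m: "m = of_real (t1 / t2)" using t by (simp add: field_simps)
  have m0: "m \<noteq> 0" and mr: "cnj m = m" using t m by auto
  let ?p = "(1 / m) \<odot> s"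
  show thesis
  proof (rule that[OF l0])
    show "?p \<noteq> 0" using s0 m0 by (simp add: smul_eq_0_iff)
    show "adj ?p = ?p" using mr by (simp add: adj_smul sadj)
    show "?p \<star> ?p = ?p" using m0 by (simp add: conv_smul_left conv_smul_right sq)
    show "a \<star> ?p = l \<odot> ?p" unfolding k by (simp add: conv_smul_right b(3) mult.commute)
    show "g \<star> ?p = ?p \<star> g" if "g \<star> a = a \<star> g" for g
      unfolding k using palg_commute[OF b(1) that] by (simp add: conv_smul_left conv_smul_right)
    show "supported K ?p" if "subgroup K G" "supported K a" for K
      unfolding k by (intro supported_smul palg_supported[OF b(1) that])
  qed
qed

section \<open>Class functions, averages over subgroups, and integrality of traces\<close>

definition class_fun :: "('a \<Rightarrow> complex) \<Rightarrow> bool" where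
  "class_fun c \<longleftrightarrow> (\<forall>x\<in>carrier G. \<forall>z\<in>carrier G. c (inv z \<otimes> x \<otimes> z) = c x)"

text \<open>For a subgroup \<open>K\<close> this is the idempotent of the trivial representation;
  \<open>avg H\<close> and \<open>avg (carrier G)\<close> are \<open>e\<^sub>H\<close> and
  \<open>e\<^sub>G\<close> of the overview.\<close>

definition avg :: "'a set \<Rightarrow> 'a \<Rightarrow> complex" where
  "avg K = (\<lambda>x. if x \<in> K then 1 / of_nat (card K) else 0)"

lemma class_funD:
  "class_fun c \<Longrightarrow> x \<in> carrier G \<Longrightarrow> z \<in> carrier G \<Longrightarrow> c (inv z \<otimes> x \<otimes> z) = c x"
  by (simp add: class_fun_def)

lemma class_fun_commute:
  assumes "class_fun c" "x \<in> carrier G" "y \<in> carrier G"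
  shows "c (x \<otimes> y) = c (y \<otimes> x)"
  using class_funD[OF assms(1), of "y \<otimes> x" y] assms(2,3) by (simp add: m_assoc[symmetric])

lemma delta_conv:
  assumes "x \<in> carrier G" "v \<in> carrier G"
  shows "(delta x \<star> b) v = b (inv x \<otimes> v)"
proof -
  have "(\<Sum>y\<in>carrier G. delta x y * b (inv y \<otimes> v)) = (\<Sum>y\<in>{x}. delta x y * b (inv y \<otimes> v))"
    by (rule sum.mono_neutral_right) (use assms fin in \<open>auto simp: delta_def\<close>)
  then show ?thesis using assms by (simp add: conv_def delta_def)
qed

lemma conv_commuted:
  assumes "x \<in> carrier G"
  shows "(f \<star> g) x = (\<Sum>y\<in>carrier G. f (x \<otimes> inv y) * g y)"
proof -
  have "(f \<star> g) x = (\<Sum>y\<in>carrier G. f (inv y) * g (inv (inv y) \<otimes> x))"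
    using assms sum_invert[of "\<lambda>y. f y * g (inv y \<otimes> x)"] by (simp add: conv_def)
  also have "\<dots> = (\<Sum>y\<in>carrier G. f (inv (y \<otimes> inv x)) * g (inv (inv (y \<otimes> inv x)) \<otimes> x))"
    using assms sum_translate_right[of "inv x" "\<lambda>y. f (inv y) * g (inv (inv y) \<otimes> x)"] by simp
  also have "\<dots> = (\<Sum>y\<in>carrier G. f (x \<otimes> inv y) * g y)"
    using assms by (intro sum.cong) (auto simp: inv_mult_group m_assoc)
  finally show ?thesis .
qed

lemma conv_delta:
  assumes "x \<in> carrier G" "v \<in> carrier G"
  shows "(b \<star> delta x) v = b (v \<otimes> inv x)"
proof -
  have "(\<Sum>y\<in>carrier G. b (v \<otimes> inv y) * delta x y) = (\<Sum>y\<in>{x}. b (v \<otimes> inv y) * delta x y)"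
    by (rule sum.mono_neutral_right) (use assms fin in \<open>auto simp: delta_def\<close>)
  then show ?thesis using assms by (simp add: conv_commuted delta_def)
qed

lemma class_fun_central:
  assumes "class_fun c"
  shows "g \<star> c = c \<star> g"
proof
  fix x
  show "(g \<star> c) x = (c \<star> g) x"
  proof (cases "x \<in> carrier G")
    case True
    then show ?thesis unfolding conv_commuted[OF True, of c]
      using class_fun_commute[OF assms] by (simp add: conv_def mult.commute)
  qed (simp add: conv_def)
qed

text \<open>Commuting with point masses suffices: compare \<open>delta z \<star> c\<close> and
  \<open>c \<star> delta z\<close> at \<open>x \<otimes> z\<close>.\<close>

lemma central_class_fun:
  assumes "\<And>g. g \<star> c = c \<star> g"
  shows "class_fun c"
  unfolding class_fun_def
proof (intro ballI)
  fix x z assume xz: "x \<in> carrier G" "z \<in> carrier G"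
  have "c (inv z \<otimes> (x \<otimes> z)) = c ((x \<otimes> z) \<otimes> inv z)"
    using xz delta_conv[of z "x \<otimes> z" c] conv_delta[of z "x \<otimes> z" c] assms[of "delta z"] by simp
  then show "c (inv z \<otimes> x \<otimes> z) = c x" using xz by (simp add: m_assoc)
qed

lemma class_fun_conv:
  assumes "class_fun c" "class_fun c'"
  shows "class_fun (c \<star> c')"
proof (rule central_class_fun)
  fix g
  have "g \<star> (c \<star> c') = (g \<star> c) \<star> c'" by (simp only: conv_assoc)
  also have "\<dots> = c \<star> (g \<star> c')" by (simp only: class_fun_central[OF assms(1), of g] conv_assoc)
  also have "\<dots> = (c \<star> c') \<star> g" by (simp only: class_fun_central[OF assms(2), of g] conv_assoc)
  finally show "g \<star> (c \<star> c') = (c \<star> c') \<star> g" .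
qed

lemma chi_add: "chi (f + g) = chi f + chi g"
  by (auto simp: fun_eq_iff chi_def sum.distrib)

lemma chi_smul: "chi (c \<odot> f) = c \<odot> chi f"
  by (auto simp: fun_eq_iff chi_def sum_distrib_left)

lemma supported_chi: "supported (carrier G) (chi f)"
  by (simp add: supported_def chi_def)

lemma class_fun_chi: "class_fun (chi f)"
  unfolding class_fun_def
proof (intro ballI)
  fix x z assume xz: "x \<in> carrier G" "z \<in> carrier G"
  have "chi f (inv z \<otimes> x \<otimes> z) = (\<Sum>y\<in>carrier G. f (inv (z \<otimes> y) \<otimes> x \<otimes> (z \<otimes> y)))"
    using xz by (simp add: chi_def inv_mult_group m_assoc)
  also have "\<dots> = chi f x"
    using xz sum_translate_left[of z "\<lambda>y. f (inv y \<otimes> x \<otimes> y)"] by (simp add: chi_def)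
  finally show "chi f (inv z \<otimes> x \<otimes> z) = chi f x" .
qed

lemma adj_chi: "adj (chi f) = chi (adj f)"
  by (auto simp: fun_eq_iff adj_def chi_def inv_mult_group m_assoc)

lemma sum_conjugate:
  assumes "z \<in> carrier G"
  shows "(\<Sum>x\<in>carrier G. F (inv z \<otimes> x \<otimes> z)) = (\<Sum>x\<in>carrier G. F x)"
  using assms sum_translate_left[of "inv z" "\<lambda>x. F (x \<otimes> z)"] sum_translate_right[of z F] by simp

lemma sum_chi: "(\<Sum>x\<in>carrier G. chi f x) = of_nat (card (carrier G)) * (\<Sum>x\<in>carrier G. f x)"
proof -
  have "(\<Sum>x\<in>carrier G. chi f x) = (\<Sum>y\<in>carrier G. \<Sum>x\<in>carrier G. f (inv y \<otimes> x \<otimes> y))"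
    unfolding chi_def by (subst sum.swap) simp
  then show ?thesis by (simp add: sum_conjugate)
qed

text \<open>Conjugating \<open>f\<close> does not change its pairing with a class function, so all
  card G conjugates contribute equally.\<close>

lemma chi_pairing:
  assumes "class_fun z"
  shows "(chi f \<star> z) \<one> = of_nat (card (carrier G)) * (f \<star> z) \<one>"
proof -
  have "(chi f \<star> z) \<one>
      = (\<Sum>y\<in>carrier G. \<Sum>x\<in>carrier G. f (inv y \<otimes> x \<otimes> y) * z (inv x))"
    unfolding conv_at_one chi_def by (subst sum.swap) (simp add: sum_distrib_right)
  also have "\<dots> = (\<Sum>y\<in>carrier G. \<Sum>x\<in>carrier G.
      f (inv y \<otimes> x \<otimes> y) * z (inv (inv y \<otimes> x \<otimes> y)))"
  proof (intro sum.cong refl)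
    fix y x assume "y \<in> carrier G" "x \<in> carrier G"
    then show "f (inv y \<otimes> x \<otimes> y) * z (inv x)
        = f (inv y \<otimes> x \<otimes> y) * z (inv (inv y \<otimes> x \<otimes> y))"
      using class_funD[OF assms, of "inv x" y] by (simp add: inv_mult_group m_assoc)
  qed
  also have "\<dots> = (\<Sum>y\<in>carrier G. \<Sum>x\<in>carrier G. f x * z (inv x))"
    by (rule sum.cong[OF refl], rule sum_conjugate[where F = "\<lambda>x. f x * z (inv x)"])
  finally show ?thesis by (simp add: conv_at_one)
qed

text \<open>The number below is the trace of the idempotent operator \<open>x \<mapsto> a x b\<close> on the group
  algebra.\<close>

lemma idempotent_conv_chi_Nats:
  assumes a: "a \<star> a = a" and b: "b \<star> b = b"
  shows "(a \<star> chi b) \<one> \<in> \<nat>"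
proof -
  \<comment> \<open>The matrix of the operator in the basis of point masses: \<open>K x z\<close> is
    the coefficient at \<open>z\<close> of the image of \<open>delta x\<close>.\<close>
  define K where "K x z = (a \<star> (delta x \<star> b)) z" for x z
  have expand: "(a \<star> (f \<star> b)) w = (\<Sum>x\<in>carrier G. f x * K x w)" if w: "w \<in> carrier G" for f w
  proof -
    have "(a \<star> (f \<star> b)) w
        = (\<Sum>y\<in>carrier G. \<Sum>x\<in>carrier G. a y * (f x * b (inv x \<otimes> (inv y \<otimes> w))))"
      using w by (simp add: conv_def sum_distrib_left)
    also have "\<dots> = (\<Sum>x\<in>carrier G. \<Sum>y\<in>carrier G. a y * (f x * b (inv x \<otimes> (inv y \<otimes> w))))"
      by (rule sum.swap)
    also have "\<dots> = (\<Sum>x\<in>carrier G. f x * (\<Sum>y\<in>carrier G. a y * b (inv x \<otimes> (inv y \<otimes> w))))"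
      by (simp add: sum_distrib_left algebra_simps)
    also have "\<dots> = (\<Sum>x\<in>carrier G. f x * K x w)"
      unfolding K_def conv_def[of a] using w delta_conv by simp
    finally show ?thesis .
  qed
  have "(\<Sum>x\<in>carrier G. K x x) \<in> \<nat>"
  proof (rule idempotent_kernel_trace_Nats[OF fin, of K])
    fix x w assume xw: "x \<in> carrier G" "w \<in> carrier G"
    have "(\<Sum>z\<in>carrier G. K x z * K z w) = (a \<star> ((a \<star> (delta x \<star> b)) \<star> b)) w"
      unfolding expand[OF xw(2)] by (simp add: K_def)
    also have "a \<star> ((a \<star> (delta x \<star> b)) \<star> b) = (a \<star> a) \<star> (delta x \<star> (b \<star> b))"
      by (simp only: conv_assoc)
    finally show "(\<Sum>z\<in>carrier G. K x z * K z w) = K x w"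
      by (simp only: a b K_def)
  qed
  moreover have "(\<Sum>x\<in>carrier G. K x x)
      = (\<Sum>x\<in>carrier G. \<Sum>y\<in>carrier G. a y * b (inv x \<otimes> (inv y \<otimes> x)))"
    unfolding K_def conv_def[of a] using delta_conv by simp
  moreover have "\<dots> = (a \<star> chi b) \<one>"
    unfolding conv_at_one chi_def
    by (subst sum.swap) (auto simp: sum_distrib_left m_assoc intro!: sum.cong)
  ultimately show ?thesis by simp
qed

text \<open>Right convolution by \<open>p\<close> is an idempotent operator on functions on
  \<open>K\<close>, and all its diagonal entries equal \<open>p \<one>\<close>. The number is the
  dimension of the representation of \<open>K\<close> afforded by \<open>p\<close>.\<close>

lemma idempotent_card_mult_Nats:
  assumes K: "subgroup K G" and supp: "supported K p" and idem: "p \<star> p = p"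
  shows "of_nat (card K) * p \<one> \<in> \<nat>"
proof -
  have KG: "K \<subseteq> carrier G" using subgroup.subset[OF K] .
  have "(\<Sum>i\<in>K. p (inv i \<otimes> i)) \<in> \<nat>"
  proof (rule idempotent_kernel_trace_Nats[where K = "\<lambda>i j. p (inv i \<otimes> j)"])
    show "finite K" using KG fin finite_subset by blast
    fix i k assume ik: "i \<in> K" "k \<in> K"
    then have ikG: "i \<in> carrier G" "k \<in> carrier G" using KG by auto
    have "(\<Sum>j\<in>K. p (inv i \<otimes> j) * p (inv j \<otimes> k))
        = (\<Sum>j\<in>carrier G. p (inv i \<otimes> j) * p (inv j \<otimes> k))"
    proof (rule sum.mono_neutral_left[OF fin KG], intro ballI)
      fix j assume j: "j \<in> carrier G - K"
      have "inv i \<otimes> j \<notin> K"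
      proof
        assume "inv i \<otimes> j \<in> K"
        from subgroup.m_closed[OF K ik(1) this] show False
          using j ikG by (simp add: m_assoc[symmetric])
      qed
      then show "p (inv i \<otimes> j) * p (inv j \<otimes> k) = 0" using supportedD[OF supp] by simp
    qed
    also have "\<dots> = (\<Sum>j\<in>carrier G. p (inv i \<otimes> (i \<otimes> j)) * p (inv (i \<otimes> j) \<otimes> k))"
      using ikG sum_translate_left[of i "\<lambda>j. p (inv i \<otimes> j) * p (inv j \<otimes> k)"] by simp
    also have "\<dots> = (p \<star> p) (inv i \<otimes> k)"
    proof -
      have "inv i \<otimes> (i \<otimes> j) = j" if "j \<in> carrier G" for j
        using that ikG by (simp add: m_assoc[symmetric])
      then show ?thesis using ikG by (simp add: conv_def inv_mult_group m_assoc)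
    qed
    finally show "(\<Sum>j\<in>K. p (inv i \<otimes> j) * p (inv j \<otimes> k)) = p (inv i \<otimes> k)"
      by (simp add: idem)
  qed
  moreover have "(\<Sum>i\<in>K. p (inv i \<otimes> i)) = (\<Sum>i\<in>K. p \<one>)"
    using KG by (intro sum.cong) auto
  ultimately show ?thesis by simp
qed

lemma subgroup_card_pos: "subgroup K G \<Longrightarrow> card K > 0"
  by (metis card_gt_0_iff empty_iff fin finite_subset subgroup.one_closed subgroup.subset)

lemma supported_avg: "supported K (avg K)"
  by (simp add: supported_def avg_def)

lemma adj_avg:
  assumes "subgroup K G"
  shows "adj (avg K) = avg K"
proof
  fix x
  have "x \<in> K \<Longrightarrow> x \<in> carrier G" using subgroup.subset[OF assms] by auto
  moreover have "x \<in> carrier G \<Longrightarrow> inv x \<in> K \<longleftrightarrow> x \<in> K"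
    using subgroup.m_inv_closed[OF assms] inv_inv by metis
  ultimately show "adj (avg K) x = avg K x" by (auto simp: adj_def avg_def)
qed

text \<open>Translation by an element of \<open>K\<close> fixes \<open>avg K\<close>, so each point
  of \<open>K\<close> contributes its coefficient in \<open>f\<close> times
  \<open>avg K\<close>.\<close>

lemma avg_absorb_left:
  assumes K: "subgroup K G" and f: "supported K f"
  shows "f \<star> avg K = (\<Sum>x\<in>carrier G. f x) \<odot> avg K"
proof
  fix x
  have KG: "K \<subseteq> carrier G" using subgroup.subset[OF K] .
  show "(f \<star> avg K) x = ((\<Sum>x\<in>carrier G. f x) \<odot> avg K) x"
  proof (cases "x \<in> K")
    case True
    have "f y * avg K (inv y \<otimes> x) = f y * avg K x" if "y \<in> carrier G" for y
    proof (cases "y \<in> K")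
      case yK: True
      have "inv y \<otimes> x \<in> K" using K True yK by (simp add: subgroup.m_closed subgroup.m_inv_closed)
      then show ?thesis using True by (simp add: avg_def)
    qed (use supportedD[OF f] in simp)
    then have "(\<Sum>y\<in>carrier G. f y * avg K (inv y \<otimes> x)) = (\<Sum>y\<in>carrier G. f y * avg K x)"
      by (rule sum.cong[OF refl])
    then show ?thesis using True KG by (auto simp: conv_def sum_distrib_right)
  next
    case False
    then show ?thesis using supportedD[OF supported_conv[OF K f supported_avg] False]
      by (simp add: avg_def)
  qed
qed

lemma sum_avg:
  assumes "subgroup K G"
  shows "(\<Sum>x\<in>carrier G. avg K x) = 1"
proof -
  have "(\<Sum>x\<in>carrier G. avg K x) = (\<Sum>x\<in>K. avg K x)"
    using subgroup.subset[OF assms] by (intro sum.mono_neutral_right) (auto simp: fin avg_def)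
  then show ?thesis using subgroup_card_pos[OF assms] by (simp add: avg_def)
qed

lemma avg_idempotent: "subgroup K G \<Longrightarrow> avg K \<star> avg K = avg K"
  by (simp add: avg_absorb_left supported_avg sum_avg)

lemma adj_delta:
  assumes "x \<in> carrier G"
  shows "adj (delta x) = delta (inv x)"
  using assms by (auto simp: fun_eq_iff adj_def delta_def)

lemma supported_delta: "x \<in> K \<Longrightarrow> supported K (delta x)"
  by (auto simp: supported_def delta_def)

text \<open>Among the nonzero self-adjoint idempotents orthogonal to \<open>avg K\<close>,
  \<open>e\<close> is chosen with the least trace \<open>card K * e \<one>\<close>, a natural
  number. It affords a nontrivial irreducible representation of \<open>K\<close>, and the last
  property is Schur's lemma for it.\<close>

lemma minimal_idempotent_exists:
  assumes K: "subgroup K G" and Knt: "K \<noteq> {\<one>}"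
  obtains e where "supported K e" "adj e = e" "e \<star> e = e" "e \<noteq> 0" "e \<star> avg K = 0"
    "\<And>x. x \<in> K \<Longrightarrow> \<exists>c. e \<star> (delta x \<star> e) = c \<odot> e"
proof -
  define P where "P p \<longleftrightarrow> supported K p \<and> adj p = p \<and> p \<star> p = p \<and> p \<noteq> 0 \<and> p \<star> avg K = 0" for p
  have KG: "K \<subseteq> carrier G" using subgroup.subset[OF K] .
  have one: "\<one> \<in> K" using subgroup.one_closed[OF K] .
  have hpos: "card K > 0" by (rule subgroup_card_pos[OF K])
  have sd: "supported K (delta \<one>)" using one by (rule supported_delta)
  note dc = delta_one_conv[OF supported_subset[OF sd KG]]
    delta_one_conv[OF supported_subset[OF supported_avg KG]]
    conv_delta_one[OF supported_subset[OF supported_avg KG]]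
  \<comment> \<open>The complement of the trivial idempotent is a candidate; it is nonzero because
    at an element of \<open>K\<close> other than \<open>\<one>\<close> its value is -1 /
    \<open>card K\<close>.\<close>
  have "P (delta \<one> + (- 1) \<odot> avg K)" unfolding P_def
  proof (intro conjI)
    let ?e = "delta \<one> + (- 1) \<odot> avg K"
    show "supported K ?e" by (intro supported_add supported_smul supported_avg sd)
    show "adj ?e = ?e"
      by (simp only: adj_add adj_smul adj_delta_one adj_avg[OF K] complex_cnj_minus complex_cnj_one)
    show "?e \<star> ?e = ?e"
      unfolding conv_add_left conv_add_right conv_smul_left conv_smul_right dc avg_idempotent[OF K]
      by (simp add: fun_eq_iff)
    show "?e \<star> avg K = 0"
      unfolding conv_add_left conv_smul_left dc avg_idempotent[OF K] by (simp add: fun_eq_iff)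
    obtain x where x: "x \<in> K" "x \<noteq> \<one>" using Knt one by blast
    then have "?e x \<noteq> 0" using hpos by (simp add: delta_def avg_def)
    then show "?e \<noteq> 0" by (metis zero_fun_apply)
  qed
  moreover have ex_nat: "\<exists>k::nat. of_nat (card K) * p \<one> = of_nat k" if "P p" for p
    using idempotent_card_mult_Nats[OF K, of p] that by (auto simp: P_def Nats_def)
  ultimately have ex: "\<exists>k::nat. \<exists>p. P p \<and> of_nat (card K) * p \<one> = of_nat k" by blast
  define k where "k = (LEAST k::nat. \<exists>p. P p \<and> of_nat (card K) * p \<one> = of_nat k)"
  obtain e where e: "P e" "of_nat (card K) * e \<one> = of_nat k"
    using LeastI_ex[OF ex] unfolding k_def by blast
  have least: "k \<le> k'" if "P p" "of_nat (card K) * p \<one> = of_nat k'" for k' p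
    unfolding k_def using that by (intro Least_le) blast
  have es: "supported K e" "adj e = e" "e \<star> e = e" "e \<noteq> 0" "e \<star> avg K = 0"
    using e(1) by (auto simp: P_def)
  \<comment> \<open>The spectral idempotent \<open>p\<close> of \<open>b\<close> satisfies
    \<open>e \<star> p = p\<close>, so it lies below \<open>e\<close>, and minimality of the trace
    makes the two equal.\<close>
  have scalar: "\<exists>c. b = c \<odot> e"
    if bs: "supported K b" and ba: "adj b = b" and eb: "e \<star> b = b" for b
  proof (cases "b = 0")
    case True
    then have "b = 0 \<odot> e" by simp
    then show ?thesis by blast
  next
    case False
    obtain l p where lp: "l \<noteq> 0" "p \<noteq> 0" "adj p = p" "p \<star> p = p" "b \<star> p = l \<odot> p"
      and ps: "\<And>K. subgroup K G \<Longrightarrow> supported K b \<Longrightarrow> supported K p"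
      by (rule spectral_idempotent[OF False supported_subset[OF bs KG] ba]) (rule that; assumption)
    have psK: "supported K p" by (rule ps[OF K bs])
    have "l \<odot> (e \<star> p) = (e \<star> b) \<star> p" by (simp only: conv_assoc lp(5) conv_smul_right)
    also have "\<dots> = l \<odot> p" by (simp only: eb lp(5))
    finally have "(1 / l) \<odot> (l \<odot> (e \<star> p)) = (1 / l) \<odot> (l \<odot> p)" by (simp only:)
    then have ep: "e \<star> p = p" using lp(1) by (simp only: smul_smul) simp
    then have pe: "p \<star> e = p" using adj_conv[of e p] lp(3) es(2) by simp
    have "p \<star> avg K = p \<star> (e \<star> avg K)" by (simp only: pe conv_assoc[symmetric])
    then have "p \<star> avg K = 0" by (simp add: es(5))
    then have Pp: "P p" using psK lp by (simp add: P_def)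
    define q where "q = e + (- 1) \<odot> p"
    have q: "adj q = q" "q \<star> q = q"
      unfolding q_def conv_add_left conv_add_right conv_smul_left conv_smul_right ep pe es(3) lp(4)
      by (simp add: adj_add adj_smul es(2) lp(3), simp add: fun_eq_iff)
    have qs: "supported (carrier G) q"
      unfolding q_def using supported_subset[OF es(1) KG] supported_subset[OF psK KG]
      by (intro supported_add supported_smul)
    \<comment> \<open>Otherwise \<open>q \<one>\<close> is positive, being a squared norm, and
      \<open>p\<close> would be a candidate of smaller trace than \<open>e\<close>.\<close>
    have "q = 0"
    proof (rule ccontr)
      assume "q \<noteq> 0"
      from adj_conv_self_pos[OF qs this] obtain t :: real where t: "t > 0" "q \<one> = of_real t"
        unfolding q by blast
      obtain k' :: nat where k': "of_nat (card K) * p \<one> = of_nat k'" using ex_nat[OF Pp] by blast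
      have "e \<one> = p \<one> + of_real t" using t(2) by (simp add: q_def algebra_simps)
      then have "of_nat k = of_nat k' + complex_of_real (real (card K) * t)"
        using e(2) k' by (simp add: algebra_simps)
      then have "complex_of_real (real k) = complex_of_real (real k' + real (card K) * t)" by simp
      then have "real k = real k' + real (card K) * t" by (simp only: of_real_eq_iff)
      moreover have "real (card K) * t > 0" using hpos t by simp
      ultimately show False using least[OF Pp k'] by simp
    qed
    then have "p = e" by (auto simp: q_def fun_eq_iff)
    moreover have "b = b \<star> e" using adj_conv[of e b] eb ba es(2) by simp
    ultimately have "b = l \<odot> e" using lp(5) by simp
    then show ?thesis by blast
  qed
  show thesis
  proof (rule that[OF es])
    fix x assume x: "x \<in> K"
    define a where "a = e \<star> (delta x \<star> e)"
    have xs: "supported K (delta x)" using x by (rule supported_delta)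
    have as: "supported K a" unfolding a_def by (intro supported_conv K es xs)
    have aa: "supported K (adj a)" by (rule supported_adj[OF K as])
    have ad: "adj (adj a) = a" by (rule adj_adj[OF supported_subset[OF as KG]])
    have ea: "e \<star> a = a" unfolding a_def by (simp only: conv_assoc[symmetric] es(3))
    have eaa: "e \<star> adj a = adj a"
      unfolding a_def by (simp only: adj_conv es(2) conv_assoc[symmetric] es(3))
    \<comment> \<open>Since \<open>scalar\<close> covers only self-adjoint elements,
      \<open>a\<close> is split into its self-adjoint and skew-adjoint parts; the factor
      \<open>\<i>\<close> makes the latter self-adjoint.\<close>
    obtain c1 where c1: "a + adj a = c1 \<odot> e"
    proof -
      have "adj (a + adj a) = a + adj a" by (simp only: adj_add ad add.commute)
      moreover have "e \<star> (a + adj a) = a + adj a" by (simp only: conv_add_right ea eaa)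
      ultimately show thesis
        using that scalar[OF supported_add[OF as aa]] by blast
    qed
    obtain c2 where c2: "\<i> \<odot> (a + (- 1) \<odot> adj a) = c2 \<odot> e"
    proof -
      have "adj (\<i> \<odot> (a + (- 1) \<odot> adj a)) = \<i> \<odot> (a + (- 1) \<odot> adj a)"
        by (simp add: adj_smul adj_add ad fun_eq_iff algebra_simps)
      moreover have "e \<star> (\<i> \<odot> (a + (- 1) \<odot> adj a)) = \<i> \<odot> (a + (- 1) \<odot> adj a)"
        by (simp only: conv_smul_right conv_add_right ea eaa)
      ultimately show thesis
        using that scalar[OF supported_smul[OF supported_add[OF as supported_smul[OF aa]]]] by blast
    qed
    have "a = ((c1 - \<i> * c2) / 2) \<odot> e"
    proof
      fix y
      have 1: "a y + adj a y = c1 * e y" using fun_cong[OF c1, of y] by simp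
      have 2: "\<i> * (a y - adj a y) = c2 * e y"
        using fun_cong[OF c2, of y] by simp
      have "2 * a y = (a y + adj a y) - \<i> * (\<i> * (a y - adj a y))" by (simp add: algebra_simps)
      also have "\<dots> = (c1 - \<i> * c2) * e y" unfolding 1 2 by (simp add: algebra_simps)
      finally show "a y = (((c1 - \<i> * c2) / 2) \<odot> e) y" by (simp add: field_simps)
    qed
    then show "\<exists>c. e \<star> (delta x \<star> e) = c \<odot> e" unfolding a_def by blast
  qed
qed

end

section \<open>The Frobenius kernel lies in a proper subgroup\<close>

locale malnormal = finite_group +
  fixes H :: "'a set"
  assumes sub: "subgroup H G"
    and nontrivial: "H \<noteq> {\<one>}"
    and malnormal: "x \<in> H \<Longrightarrow> x \<noteq> \<one> \<Longrightarrow> y \<in> carrier G \<Longrightarrow> inv y \<otimes> x \<otimes> y \<in> H \<Longrightarrow> y \<in> H"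
begin

definition kernel :: "'a set" where
  "kernel = {x \<in> carrier G. x = \<one> \<or> (\<forall>y\<in>carrier G. inv y \<otimes> x \<otimes> y \<notin> H)}"

lemma H_subset: "H \<subseteq> carrier G"
  using subgroup.subset[OF sub] .

lemma finite_H: "finite H"
  using H_subset fin finite_subset by blast

lemma chi_kernel:
  assumes "supported H f" "x \<in> kernel" "x \<noteq> \<one>"
  shows "chi f x = 0"
  using assms supportedD[OF assms(1)] by (auto simp: chi_def kernel_def intro!: sum.neutral)

text \<open>Malnormality enters here: an element that conjugates \<open>x\<close> into
  \<open>H\<close> lies in \<open>H\<close>, so the conjugates by elements outside \<open>H\<close>
  contribute nothing.\<close>

lemma chi_H:
  assumes f: "supported H f" and x: "x \<in> H" "x \<noteq> \<one>"
  shows "chi f x = (\<Sum>y\<in>H. f (inv y \<otimes> x \<otimes> y))"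
proof -
  have "(\<Sum>y\<in>carrier G. f (inv y \<otimes> x \<otimes> y)) = (\<Sum>y\<in>H. f (inv y \<otimes> x \<otimes> y))"
    using H_subset malnormal[OF x] supportedD[OF f]
    by (intro sum.mono_neutral_right[OF fin]) auto
  then show ?thesis using x H_subset by (auto simp: chi_def)
qed

lemma chi_one: "chi f \<one> = of_nat (card (carrier G)) * f \<one>"
  by (simp add: chi_def)

lemma chi_avg_carrier:
  assumes "x \<in> carrier G"
  shows "chi (avg (carrier G)) x = 1"
proof -
  have "chi (avg (carrier G)) x = (\<Sum>y\<in>carrier G. 1 / of_nat (card (carrier G)))"
    using assms by (auto simp: chi_def avg_def intro!: sum.cong)
  then show ?thesis using subgroup_card_pos[OF subgroup_self] by simp
qed

text \<open>Up to inversion of the argument, this is Frobenius' extension to \<open>G\<close> of the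
  irreducible character of degree \<open>d\<close> afforded by \<open>e\<close>: that character
  induced from \<open>H\<close>, minus \<open>d\<close> times the induced trivial character, plus
  \<open>d\<close>. The sum 0 will show that it is not constant, and the last property is norm
  1.\<close>

lemma exists_virtual_character:
  obtains e d where "supported H e" "adj e = e" "e \<star> e = e" "d \<in> \<nat>" "d \<noteq> 0"
    "\<And>x. x \<in> kernel \<Longrightarrow> chi (e + (- d) \<odot> avg H + d \<odot> avg (carrier G)) x = d"
    "(\<Sum>x\<in>carrier G. chi (e + (- d) \<odot> avg H + d \<odot> avg (carrier G)) x) = 0"
    "((e + (- d) \<odot> avg H + d \<odot> avg (carrier G))
      \<star> chi (e + (- d) \<odot> avg H + d \<odot> avg (carrier G))) \<one> = 1"
proof -
  obtain e where e: "supported H e" "adj e = e" "e \<star> e = e" "e \<noteq> 0" "e \<star> avg H = 0"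
    and scalar: "\<And>x. x \<in> H \<Longrightarrow> \<exists>c. e \<star> (delta x \<star> e) = c \<odot> e"
    by (rule minimal_idempotent_exists[OF sub nontrivial]) (rule that; assumption)
  have eG: "supported (carrier G) e" by (rule supported_subset[OF e(1) H_subset])
  define h where "h = (of_nat (card H) :: complex)"
  define n where "n = (of_nat (card (carrier G)) :: complex)"
  have h0: "h \<noteq> 0" using subgroup_card_pos[OF sub] by (simp add: h_def)
  have n0: "n \<noteq> 0" using subgroup_card_pos[OF subgroup_self] by (simp add: n_def)
  define d where "d = h * e \<one>"
  have e1: "e \<one> \<noteq> 0" using adj_conv_self_pos[OF eG e(4)] e(2,3) by auto
  have d0: "d \<noteq> 0" using e1 h0 by (simp add: d_def)
  have dN: "d \<in> \<nat>" unfolding d_def h_def by (rule idempotent_card_mult_Nats[OF sub e(1,3)])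
  define E where "E = e + (- d) \<odot> avg H + d \<odot> avg (carrier G)"
  define psi where "psi = chi E"
  have psi: "psi x = chi e x - d * chi (avg H) x + d" if "x \<in> carrier G" for x
    using chi_avg_carrier[OF that] by (simp add: psi_def E_def chi_add chi_smul)
  have avg1: "avg H \<one> = 1 / h" using subgroup.one_closed[OF sub] by (simp add: avg_def h_def)
  \<comment> \<open>The factor \<open>d = h * e \<one>\<close> is chosen so that the two induced
    terms cancel at \<open>\<one>\<close>.\<close>
  have psi1: "psi \<one> = d"
    using h0 by (simp add: psi chi_one avg1 n_def[symmetric] d_def field_simps)
  have psi_kernel: "psi x = d" if "x \<in> kernel" for x
  proof (cases "x = \<one>")
    case False
    have "x \<in> carrier G" using that by (simp add: kernel_def)
    then show ?thesis
      using chi_kernel[OF e(1) that False] chi_kernel[OF supported_avg that False] by (simp add: psi)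
  qed (simp add: psi1)
  \<comment> \<open>Away from \<open>\<one>\<close>, \<open>chi (avg H)\<close> equals 1 on
    \<open>H\<close>; the last two terms of \<open>psi\<close> cancel and the character of
    \<open>e\<close> on \<open>H\<close> remains.\<close>
  have psi_H: "psi x = (\<Sum>y\<in>H. e (inv y \<otimes> x \<otimes> y))" if x: "x \<in> H" for x
  proof (cases "x = \<one>")
    case True
    have "(\<Sum>y\<in>H. e (inv y \<otimes> x \<otimes> y)) = (\<Sum>y\<in>H. e \<one>)"
      using H_subset True by (intro sum.cong) auto
    then show ?thesis by (simp add: True psi1 d_def h_def)
  next
    case False
    have "chi (avg H) x = (\<Sum>y\<in>H. 1 / h)"
      unfolding chi_H[OF supported_avg x False]
    proof (rule sum.cong)
      fix y assume y: "y \<in> H"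
      have "inv y \<otimes> x \<otimes> y \<in> H"
        using x y sub by (intro subgroup.m_closed[OF sub] subgroup.m_inv_closed[OF sub])
      then show "avg H (inv y \<otimes> x \<otimes> y) = 1 / h" by (simp add: avg_def h_def)
    qed simp
    also have "\<dots> = 1" using h0 by (simp add: h_def)
    finally show ?thesis using psi[of x] x H_subset chi_H[OF e(1) x False] by auto
  qed
  have "((\<Sum>x\<in>carrier G. e x) \<odot> avg H) \<one> = 0"
    unfolding avg_absorb_left[OF sub e(1), symmetric] e(5) by simp
  then have sum_e: "(\<Sum>x\<in>carrier G. e x) = 0" using h0 by (simp add: avg1)
  have sum_E: "(\<Sum>x\<in>carrier G. E x) = 0"
  proof -
    have "(\<Sum>x\<in>carrier G. E x) = (\<Sum>x\<in>carrier G. e x)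
        + (- d) * (\<Sum>x\<in>carrier G. avg H x) + d * (\<Sum>x\<in>carrier G. avg (carrier G) x)"
      by (simp add: E_def sum.distrib sum_distrib_left sum_negf sum_subtractf)
    then show ?thesis by (simp add: sum_e sum_avg[OF sub] sum_avg[OF subgroup_self])
  qed
  have sum_psi: "(\<Sum>x\<in>carrier G. psi x) = 0"
    unfolding psi_def sum_chi sum_E by simp
  \<comment> \<open>An \<open>f\<close> supported on \<open>H\<close> sees \<open>psi\<close> only
    on \<open>H\<close>, where it is a sum of conjugates of \<open>e\<close>. In this form
    \<open>e \<star> avg H = 0\<close> and \<open>scalar\<close> become applicable.\<close>
  have pair_H: "(f \<star> psi) \<one> = (\<Sum>y\<in>H. (f \<star> (delta y \<star> (e \<star> delta (inv y)))) \<one>)"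
    if f: "supported H f" for f
  proof -
    have shift: "(delta y \<star> (e \<star> delta (inv y))) (inv x) = e (inv y \<otimes> inv x \<otimes> y)"
      if "x \<in> carrier G" "y \<in> carrier G" for x y
      using that by (simp add: delta_conv conv_delta)
    have "(f \<star> psi) \<one> = (\<Sum>x\<in>carrier G. f x * psi (inv x))" by (rule conv_at_one)
    also have "\<dots> = (\<Sum>x\<in>carrier G. \<Sum>y\<in>H. f x * e (inv y \<otimes> inv x \<otimes> y))"
    proof (rule sum.cong)
      fix x assume "x \<in> carrier G"
      show "f x * psi (inv x) = (\<Sum>y\<in>H. f x * e (inv y \<otimes> inv x \<otimes> y))"
      proof (cases "x \<in> H")
        case True
        then show ?thesis using psi_H[of "inv x"] subgroup.m_inv_closed[OF sub True]
          by (simp add: sum_distrib_left)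
      qed (use supportedD[OF f] in simp)
    qed simp
    also have "\<dots> = (\<Sum>y\<in>H. \<Sum>x\<in>carrier G. f x * e (inv y \<otimes> inv x \<otimes> y))" by (rule sum.swap)
    also have "\<dots> = (\<Sum>y\<in>H. (f \<star> (delta y \<star> (e \<star> delta (inv y)))) \<one>)"
      unfolding conv_at_one[of f] using shift H_subset by (auto intro!: sum.cong)
    finally show ?thesis .
  qed
  have avg_psi: "(avg H \<star> psi) \<one> = 0"
    unfolding pair_H[OF supported_avg]
  proof (rule sum.neutral, rule ballI)
    fix y assume y: "y \<in> H"
    then have yG: "y \<in> carrier G" using H_subset by auto
    have "avg H \<star> delta y = avg H"
    proof -
      have sd: "supported H (delta (inv y))"
        by (rule supported_delta[OF subgroup.m_inv_closed[OF sub y]])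
      have "(\<Sum>x\<in>carrier G. delta (inv y) x) = 1"
        using yG fin by (simp add: delta_def)
      then have "delta (inv y) \<star> avg H = avg H" using avg_absorb_left[OF sub sd] by simp
      then have "adj (delta (inv y) \<star> avg H) = adj (avg H)" by simp
      then show ?thesis using yG by (simp add: adj_conv adj_avg[OF sub] adj_delta)
    qed
    moreover have "avg H \<star> e = 0"
      using adj_conv[of e "avg H"] e(2,5) adj_avg[OF sub] by simp
    ultimately have "avg H \<star> (delta y \<star> (e \<star> delta (inv y))) = 0"
      by (simp only: conv_assoc[symmetric] conv_zero)
    then show "(avg H \<star> (delta y \<star> (e \<star> delta (inv y)))) \<one> = 0" by simp
  qed
  have avgG_psi: "(avg (carrier G) \<star> psi) \<one> = 0"
  proof -
    have "(avg (carrier G) \<star> psi) \<one> = (1 / n) * (\<Sum>y\<in>carrier G. psi (inv y))"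
      by (simp add: conv_at_one avg_def n_def sum_distrib_left)
    then show ?thesis using sum_psi sum_invert[of psi] by simp
  qed
  have e_psi: "(e \<star> psi) \<one> = 1"
  proof -
    \<comment> \<open>Schur orthogonality: \<open>scalar\<close> produces a constant
      \<open>c\<close>, which evaluation at \<open>\<one>\<close> determines. Summing over
      \<open>y\<close> then reproduces \<open>e \<star> e = e\<close> at
      \<open>\<one>\<close>.\<close>
    have "(e \<star> (delta y \<star> (e \<star> delta (inv y)))) \<one> = e y * e (inv y) / e \<one>" if y: "y \<in> H" for y
    proof -
      have yG: "y \<in> carrier G" using y H_subset by auto
      obtain c where c: "e \<star> (delta y \<star> e) = c \<odot> e" using scalar[OF y] by blast
      have "c * e \<one> = (e \<star> (delta y \<star> e)) \<one>" using c by simp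
      also have "\<dots> = ((delta y \<star> e) \<star> e) \<one>" by (rule conv_at_one_commute)
      also have "\<dots> = e (inv y)" using yG by (simp add: conv_assoc e(3) delta_conv)
      finally have c': "c = e (inv y) / e \<one>" using e1 by (simp add: field_simps)
      have "e \<star> (delta y \<star> (e \<star> delta (inv y))) = (e \<star> (delta y \<star> e)) \<star> delta (inv y)"
        by (simp only: conv_assoc)
      then have "e \<star> (delta y \<star> (e \<star> delta (inv y))) = c \<odot> (e \<star> delta (inv y))"
        by (simp only: c conv_smul_left)
      then show ?thesis using yG c' by (simp add: conv_delta)
    qed
    then have "(e \<star> psi) \<one> = (\<Sum>y\<in>H. e y * e (inv y)) / e \<one>"
      by (simp add: pair_H[OF e(1)] sum_divide_distrib)
    also have "(\<Sum>y\<in>H. e y * e (inv y)) = (\<Sum>y\<in>carrier G. e y * e (inv y))"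
      using H_subset supportedD[OF e(1)] by (intro sum.mono_neutral_left[OF fin]) auto
    also have "\<dots> = e \<one>" using conv_at_one[of e e] by (simp add: e(3))
    finally show ?thesis using e1 by simp
  qed
  have "(E \<star> psi) \<one> = 1"
    unfolding E_def conv_add_left conv_smul_left using e_psi avg_psi avgG_psi by simp
  then show thesis
    using that[OF e(1-3) dN d0] psi_kernel sum_psi unfolding psi_def E_def by blast
qed

text \<open>For a central self-adjoint idempotent \<open>u\<close>, \<open>J u\<close> is an integer
  and \<open>of_nat n * J u\<close> is the squared norm of \<open>u \<star> psi\<close>. The
  decomposition of \<open>delta \<one>\<close> into \<open>p\<close> and \<open>q\<close> splits the
  total 1 into two nonnegative integers, so one component vanishes and \<open>psi\<close> is a
  multiple of \<open>p\<close>. The subgroup sought is the left stabiliser of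
  \<open>psi\<close>.\<close>

lemma kernel_in_proper_subgroup: "\<exists>K. subgroup K G \<and> kernel \<subseteq> K \<and> K \<noteq> carrier G"
proof -
  obtain e d where e: "supported H e" "adj e = e" "e \<star> e = e" and d: "d \<in> \<nat>" "d \<noteq> 0"
    and psiN: "\<And>x. x \<in> kernel \<Longrightarrow> chi (e + (- d) \<odot> avg H + d \<odot> avg (carrier G)) x = d"
    and sumpsi: "(\<Sum>x\<in>carrier G. chi (e + (- d) \<odot> avg H + d \<odot> avg (carrier G)) x) = 0"
    and norm1: "((e + (- d) \<odot> avg H + d \<odot> avg (carrier G))
      \<star> chi (e + (- d) \<odot> avg H + d \<odot> avg (carrier G))) \<one> = 1"
    by (rule exists_virtual_character) (rule that; assumption)
  define E where "E = e + (- d) \<odot> avg H + d \<odot> avg (carrier G)"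
  define psi where "psi = chi E"
  note psiN = psiN[folded E_def, folded psi_def]
  note sumpsi = sumpsi[folded E_def, folded psi_def]
  note norm1 = norm1[folded E_def, folded psi_def]
  define n where "n = card (carrier G)"
  have npos: "n > 0" unfolding n_def by (rule subgroup_card_pos[OF subgroup_self])
  have dc: "cnj d = d" using d(1) by (auto simp: Nats_def)
  have adjE: "adj E = E"
    unfolding E_def by (simp only: adj_add adj_smul e(2) adj_avg[OF sub] adj_avg[OF subgroup_self]
        complex_cnj_minus dc)
  have adjpsi: "adj psi = psi" unfolding psi_def adj_chi adjE ..
  have psis: "supported (carrier G) psi" unfolding psi_def by (rule supported_chi)
  have psic: "class_fun psi" unfolding psi_def by (rule class_fun_chi)
  have cent: "g \<star> psi = psi \<star> g" for g by (rule class_fun_central[OF psic])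
  have one_kernel: "\<one> \<in> kernel" by (simp add: kernel_def)
  have psi1: "psi \<one> = d" by (rule psiN[OF one_kernel])
  have psi0: "psi \<noteq> 0" using psi1 d(2) by auto
  obtain l p where lp: "l \<noteq> 0" "p \<noteq> 0" "adj p = p" "p \<star> p = p" "psi \<star> p = l \<odot> p"
    and comm: "\<And>g. g \<star> psi = psi \<star> g \<Longrightarrow> g \<star> p = p \<star> g"
    and ps: "\<And>K. subgroup K G \<Longrightarrow> supported K psi \<Longrightarrow> supported K p"
    by (rule spectral_idempotent[OF psi0 psis adjpsi]) (rule that; assumption)
  have pcent: "g \<star> p = p \<star> g" for g by (rule comm[OF cent])
  have psup: "supported (carrier G) p" by (rule ps[OF subgroup_self psis])
  define J where "J u = ((u \<star> E) \<star> psi) \<one>" for u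
  have J_Ints: "J u \<in> \<int>" if u: "u \<star> u = u" and uc: "\<And>g. g \<star> u = u \<star> g" for u
  proof -
    have dI: "d \<in> \<int>" using d(1) by (auto simp: Nats_def)
    have idem: "(u \<star> f) \<star> (u \<star> f) = u \<star> f" if "f \<star> f = f" for f
    proof -
      have "(u \<star> f) \<star> (u \<star> f) = u \<star> ((f \<star> u) \<star> f)" by (simp only: conv_assoc)
      also have "\<dots> = (u \<star> u) \<star> (f \<star> f)" by (simp only: uc[of f] conv_assoc)
      finally show ?thesis by (simp only: u that)
    qed
    \<comment> \<open>Since \<open>u\<close> is central, \<open>u \<star> f\<close> is again
      idempotent, so the trace lemma applies; \<open>E\<close> is an integral combination of three
      idempotents in each of the two arguments.\<close>
    have B: "((u \<star> f) \<star> chi g) \<one> \<in> \<int>" if "f \<star> f = f" "g \<star> g = g" for f g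
      using idempotent_conv_chi_Nats[OF idem[OF that(1)] that(2)] Nats_subset_Ints by blast
    note idems = e(3) avg_idempotent[OF sub] avg_idempotent[OF subgroup_self]
    have B': "((u \<star> E) \<star> chi g) \<one> \<in> \<int>" if g: "g \<star> g = g" for g
      unfolding E_def conv_add_right conv_smul_right conv_add_left conv_smul_left
        plus_fun_apply smul_apply
      by (intro Ints_add Ints_mult Ints_minus dI B idems g)
    show ?thesis
      unfolding J_def psi_def
      by (subst (2) E_def) (unfold chi_add chi_smul conv_add_right conv_smul_right
          plus_fun_apply smul_apply, intro Ints_add Ints_mult Ints_minus dI B' idems)
  qed
  have J_norm: "of_nat n * J u = (adj (u \<star> psi) \<star> (u \<star> psi)) \<one>"
    if u: "u \<star> u = u" and uc: "\<And>g. g \<star> u = u \<star> g" and ua: "adj u = u" for u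
  proof -
    have "J u = (u \<star> (E \<star> psi)) \<one>" by (simp only: J_def conv_assoc)
    also have "\<dots> = ((E \<star> psi) \<star> u) \<one>" by (rule conv_at_one_commute)
    also have "\<dots> = (E \<star> (psi \<star> u)) \<one>" by (simp only: conv_assoc)
    finally have "of_nat n * J u = (psi \<star> (psi \<star> u)) \<one>"
      using chi_pairing[OF class_fun_conv[OF psic central_class_fun[OF uc]], of E]
      by (simp add: psi_def n_def)
    also have "psi \<star> (psi \<star> u) = (psi \<star> u) \<star> (u \<star> psi)"
    proof -
      have "(psi \<star> u) \<star> (u \<star> psi) = psi \<star> ((u \<star> u) \<star> psi)" by (simp only: conv_assoc)
      then show ?thesis by (simp only: u cent[of u])
    qed
    also have "\<dots> = adj (u \<star> psi) \<star> (u \<star> psi)" by (simp only: adj_conv ua adjpsi)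
    finally show ?thesis .
  qed
  have J_pos: "\<exists>k::int. k > 0 \<and> J u = of_int k"
    if u: "u \<star> u = u" and uc: "\<And>g. g \<star> u = u \<star> g" and ua: "adj u = u" and nz: "u \<star> psi \<noteq> 0" for u
  proof -
    obtain k where k: "J u = of_int k" using J_Ints[OF u uc] by (auto simp: Ints_def)
    obtain t :: real where t: "t > 0" "of_nat n * J u = of_real t"
      using adj_conv_self_pos[OF supported_conv_carrier nz] J_norm[OF u uc ua] by auto
    have "complex_of_real (real n * of_int k) = of_real t" using t(2) k by simp
    then have "real n * of_int k = t" by (simp only: of_real_eq_iff)
    then have "k > 0" using t(1) npos by (metis mult_pos_pos of_int_0_less_iff of_nat_0_less_iff zero_less_mult_pos)
    then show ?thesis using k by blast
  qed
  define q where "q = delta \<one> + (- 1) \<odot> p"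
  have dd: "supported (carrier G) (delta \<one>)" by (simp add: supported_delta)
  have cdelta: "class_fun (delta \<one>)"
  proof (rule central_class_fun)
    fix g
    show "g \<star> delta \<one> = delta \<one> \<star> g"
    proof
      fix x show "(g \<star> delta \<one>) x = (delta \<one> \<star> g) x"
        by (cases "x \<in> carrier G") (simp_all add: delta_conv conv_delta, simp add: conv_def)
    qed
  qed
  have q: "q \<star> q = q" "adj q = q"
    unfolding q_def conv_add_left conv_add_right conv_smul_left conv_smul_right lp(4)
      delta_one_conv[OF dd] delta_one_conv[OF psup] conv_delta_one[OF psup]
    by (simp add: fun_eq_iff, simp add: adj_add adj_smul adj_delta_one lp(3))
  have qc: "g \<star> q = q \<star> g" for g
    unfolding q_def conv_add_left conv_add_right conv_smul_left conv_smul_right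
      pcent[of g] class_fun_central[OF cdelta, of g] ..
  have "J p + J q = 1"
  proof -
    have "J q = (E \<star> psi) \<one> - J p"
    proof -
      have Es: "supported (carrier G) E"
        unfolding E_def using supported_subset[OF _ H_subset] e(1)
        by (intro supported_add supported_smul) (auto intro: supported_avg)
      show ?thesis
        unfolding J_def q_def conv_add_left conv_smul_left delta_one_conv[OF Es] by simp
    qed
    then show ?thesis using norm1 by simp
  qed
  moreover obtain k :: int where k: "k > 0" "J p = of_int k"
  proof -
    have "p \<star> psi = l \<odot> p" by (simp only: cent[of p] lp(5))
    then have "p \<star> psi \<noteq> 0" using lp(1,2) by (simp only: smul_eq_0_iff) simp
    then show thesis using that J_pos[OF lp(4) pcent lp(3)] by blast
  qed
  ultimately have Jq: "J q = of_int (1 - k)" by (simp add: algebra_simps)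
  \<comment> \<open>Otherwise \<open>J p\<close> and \<open>J q\<close> would both be at least 1,
    while they add up to 1.\<close>
  have "q \<star> psi = 0"
  proof (rule ccontr)
    assume "q \<star> psi \<noteq> 0"
    then obtain k' :: int where "k' > 0" "J q = of_int k'" using J_pos[OF q(1) qc q(2)] by blast
    then have "k' = 1 - k" using Jq of_int_eq_iff[where 'a = complex] by metis
    then show False using \<open>k' > 0\<close> k(1) by simp
  qed
  then have "psi = p \<star> psi"
    unfolding q_def conv_add_left conv_smul_left delta_one_conv[OF psis]
    by (auto simp: fun_eq_iff)
  then have psip: "psi = l \<odot> p" by (simp only: cent[of p] lp(5))
  have psq: "psi \<star> psi = l \<odot> psi"
    using lp(5) by (subst (2 3) psip) (simp only: conv_smul_right)
  have psq1: "(psi \<star> psi) \<one> = of_nat n"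
    using chi_pairing[OF psic, of E] norm1 by (simp add: psi_def n_def)
  have psiadj: "cnj (psi x) = psi (inv x)" if "x \<in> carrier G" for x
    using fun_cong[OF adjpsi, of "inv x"] that by (simp add: adj_def)
  \<comment> \<open>Since \<open>psi \<star> psi\<close> is a multiple of \<open>psi\<close>, it
    takes equal values at \<open>t\<close> and \<open>\<one>\<close>. So \<open>psi\<close> and its
    translate \<open>g\<close> have the same squared norm, their inner product equals it, and the
    norm of \<open>psi - g\<close> is 0.\<close>
  have inv_kernel: "psi (inv t \<otimes> x) = psi x" if t: "t \<in> kernel" and x: "x \<in> carrier G" for t x
  proof -
    have tG: "t \<in> carrier G" using t by (simp add: kernel_def)
    define g where "g y = psi (inv t \<otimes> y)" for y
    have gg: "(\<Sum>y\<in>carrier G. g y * cnj (g y)) = of_nat n"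
      and pp: "(\<Sum>y\<in>carrier G. psi y * cnj (psi y)) = of_nat n"
    proof -
      show pp: "(\<Sum>y\<in>carrier G. psi y * cnj (psi y)) = of_nat n"
        using psq1 psiadj by (simp add: conv_at_one)
      show "(\<Sum>y\<in>carrier G. g y * cnj (g y)) = of_nat n"
        unfolding g_def pp[symmetric]
        using tG sum_translate_left[of "inv t" "\<lambda>y. psi y * cnj (psi y)"] by simp
    qed
    have pg: "(\<Sum>y\<in>carrier G. psi y * cnj (g y)) = of_nat n"
    proof -
      have "(\<Sum>y\<in>carrier G. psi y * cnj (g y)) = (psi \<star> psi) t"
        using tG psiadj by (simp add: g_def conv_def inv_mult_group)
      also have "\<dots> = (psi \<star> psi) \<one>" unfolding psq by (simp add: psiN[OF t] psi1)
      finally show ?thesis by (simp add: psq1)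
    qed
    have gp: "(\<Sum>y\<in>carrier G. g y * cnj (psi y)) = of_nat n"
      using arg_cong[OF pg, of cnj] by (simp add: mult.commute)
    have "complex_of_real (\<Sum>y\<in>carrier G. (cmod (psi y - g y))\<^sup>2)
        = (\<Sum>y\<in>carrier G. (psi y - g y) * cnj (psi y - g y))"
      by (simp add: complex_norm_square del: of_real_power)
    also have "\<dots> = (\<Sum>y\<in>carrier G. psi y * cnj (psi y)) - (\<Sum>y\<in>carrier G. psi y * cnj (g y))
        - (\<Sum>y\<in>carrier G. g y * cnj (psi y)) + (\<Sum>y\<in>carrier G. g y * cnj (g y))"
      by (simp add: algebra_simps sum.distrib sum_subtractf)
    also have "\<dots> = 0" unfolding pp gg pg gp by simp
    finally have "(\<Sum>y\<in>carrier G. (cmod (psi y - g y))\<^sup>2) = 0" by (simp only: of_real_eq_0_iff)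
    then have "(cmod (psi x - g x))\<^sup>2 = 0"
      using x by (subst (asm) sum_nonneg_eq_0_iff) (auto simp: fin)
    then show ?thesis by (simp add: g_def)
  qed
  define K where "K = {t \<in> carrier G. \<forall>x\<in>carrier G. psi (t \<otimes> x) = psi x}"
  have "subgroup K G"
  proof (rule subgroupI)
    show "K \<subseteq> carrier G" by (auto simp: K_def)
    show "K \<noteq> {}" by (auto simp: K_def intro!: exI[of _ \<one>])
    show "inv t \<in> K" if "t \<in> K" for t
      unfolding K_def
    proof (intro CollectI conjI ballI)
      show "inv t \<in> carrier G" using that by (simp add: K_def)
      fix x assume x: "x \<in> carrier G"
      have "psi (t \<otimes> (inv t \<otimes> x)) = psi (inv t \<otimes> x)" using that x by (simp add: K_def)
      then show "psi (inv t \<otimes> x) = psi x" using that x by (simp add: K_def m_assoc[symmetric])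
    qed
    show "s \<otimes> t \<in> K" if "s \<in> K" "t \<in> K" for s t
      using that by (simp add: K_def m_assoc)
  qed
  moreover have "kernel \<subseteq> K"
  proof
    fix t assume t: "t \<in> kernel"
    then have tG: "t \<in> carrier G" by (simp add: kernel_def)
    show "t \<in> K" unfolding K_def
    proof (intro CollectI conjI ballI tG)
      fix x assume x: "x \<in> carrier G"
      have "psi (inv t \<otimes> (t \<otimes> x)) = psi (t \<otimes> x)" using t tG x by (intro inv_kernel) auto
      then show "psi (t \<otimes> x) = psi x" using tG x by (simp add: m_assoc[symmetric])
    qed
  qed
  \<comment> \<open>A function invariant under all translations is constant, here with value
    \<open>d \<noteq> 0\<close>, against the sum 0 of \<open>psi\<close>.\<close>
  moreover have "K \<noteq> carrier G"
  proof
    assume KG: "K = carrier G"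
    have "psi x = d" if "x \<in> carrier G" for x
    proof -
      have "x \<in> K" using that KG by simp
      then have "psi (x \<otimes> \<one>) = psi \<one>" unfolding K_def by blast
      then show ?thesis using that psi1 by simp
    qed
    then have "(\<Sum>x\<in>carrier G. psi x) = of_nat n * d" by (simp add: n_def)
    then show False using sumpsi npos d(2) by simp
  qed
  ultimately show ?thesis by blast
qed

end

section \<open>Cayley graphs of small complement\<close>

lemma vertex_list:
  assumes "finite V"
  shows "set (vertex_list V) = V" "distinct (vertex_list V)" "length (vertex_list V) = card V"
proof -
  have "set (vertex_list V) = V \<and> distinct (vertex_list V)"
    unfolding vertex_list_def using finite_distinct_list[OF assms] by (rule someI_ex)
  then show "set (vertex_list V) = V" "distinct (vertex_list V)" "length (vertex_list V) = card V"
    using distinct_card[of "vertex_list V"] by auto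
qed

text \<open>Eigenvectors become functions on \<open>V\<close>, which removes the choice made by
  \<open>vertex_list\<close>.\<close>

lemma eigenvalue_adjacency_matrix_iff:
  assumes fin: "finite V"
  shows "eigenvalue (adjacency_matrix V E) z \<longleftrightarrow>
    (\<exists>f. (\<exists>x\<in>V. f x \<noteq> 0) \<and> (\<forall>x\<in>V. (\<Sum>y\<in>{y \<in> V. E x y}. f y) = z * f x))"
proof -
  let ?v = "\<lambda>i. vertex_list V ! i" and ?n = "card V" and ?A = "adjacency_matrix V E"
  have bij: "bij_betw ?v {..<?n} V"
    using bij_betw_nth[of "vertex_list V" "{..<?n}" V] vertex_list[OF fin] by auto
  have mem: "?v i \<in> V" if "i < ?n" for i using bij that by (auto dest: bij_betwE)
  have row: "(?A *\<^sub>v vec ?n (\<lambda>j. f (?v j))) $ i = (\<Sum>y\<in>{y \<in> V. E (?v i) y}. f y)"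
    if i: "i < ?n" for f :: "'a \<Rightarrow> complex" and i
  proof -
    have "(?A *\<^sub>v vec ?n (\<lambda>j. f (?v j))) $ i
        = (\<Sum>j<?n. (if E (?v i) (?v j) then 1 else 0) * f (?v j))"
      using i by (simp add: adjacency_matrix_def scalar_prod_def atLeast0LessThan)
    also have "\<dots> = (\<Sum>y\<in>V. (if E (?v i) y then 1 else 0) * f y)"
      by (rule sum.reindex_bij_betw[OF bij])
    also have "\<dots> = (\<Sum>y\<in>{y \<in> V. E (?v i) y}. f y)"
      by (subst sum.inter_filter[OF fin]) (rule sum.cong, auto)
    finally show ?thesis .
  qed
  have dim: "dim_row ?A = ?n" by (simp add: adjacency_matrix_def)
  show ?thesis
  proof
    assume "eigenvalue ?A z"
    then obtain w where w: "w \<in> carrier_vec ?n" "w \<noteq> 0\<^sub>v ?n" "?A *\<^sub>v w = z \<cdot>\<^sub>v w"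
      by (auto simp: eigenvalue_def eigenvector_def dim)
    define f where "f x = w $ (the_inv_into {..<?n} ?v x)" for x
    have fv: "f (?v j) = w $ j" if "j < ?n" for j
      using the_inv_into_f_f[OF bij_betw_imp_inj_on[OF bij], of j] that by (simp add: f_def)
    have wf: "w = vec ?n (\<lambda>j. f (?v j))" using w(1) fv by (intro eq_vecI) auto
    show "\<exists>f. (\<exists>x\<in>V. f x \<noteq> 0) \<and> (\<forall>x\<in>V. (\<Sum>y\<in>{y \<in> V. E x y}. f y) = z * f x)"
    proof (intro exI[of _ f] conjI ballI)
      show "\<exists>x\<in>V. f x \<noteq> 0"
      proof (rule ccontr)
        assume "\<not> ?thesis"
        then have "w = 0\<^sub>v ?n" using w(1) fv mem by (intro eq_vecI) force+
        with w(2) show False by simp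
      qed
      fix x assume "x \<in> V"
      then obtain i where i: "i < ?n" "x = ?v i" using bij by (auto simp: bij_betw_def)
      have "(\<Sum>y\<in>{y \<in> V. E x y}. f y) = (?A *\<^sub>v w) $ i"
        unfolding i(2) by (subst wf) (rule row[OF i(1), symmetric])
      also have "\<dots> = z * f x" using w(1,3) i fv by simp
      finally show "(\<Sum>y\<in>{y \<in> V. E x y}. f y) = z * f x" .
    qed
  next
    assume "\<exists>f. (\<exists>x\<in>V. f x \<noteq> 0) \<and> (\<forall>x\<in>V. (\<Sum>y\<in>{y \<in> V. E x y}. f y) = z * f x)"
    then obtain f x where f: "x \<in> V" "f x \<noteq> 0" "\<And>x. x \<in> V \<Longrightarrow> (\<Sum>y\<in>{y \<in> V. E x y}. f y) = z * f x"
      by blast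
    obtain i where i: "i < ?n" "x = ?v i" using bij f(1) by (auto simp: bij_betw_def)
    let ?w = "vec ?n (\<lambda>j. f (?v j))"
    have "?w \<noteq> 0\<^sub>v ?n"
    proof
      assume "?w = 0\<^sub>v ?n"
      then have "?w $ i = 0" using i by simp
      then show False using i f(2) by simp
    qed
    moreover have "?A *\<^sub>v ?w = z \<cdot>\<^sub>v ?w"
    proof (rule eq_vecI)
      fix j assume "j < dim_vec (z \<cdot>\<^sub>v ?w)"
      then have j: "j < ?n" by simp
      show "(?A *\<^sub>v ?w) $ j = (z \<cdot>\<^sub>v ?w) $ j"
        unfolding row[OF j] using f(3)[OF mem[OF j]] j by simp
    qed (simp add: dim)
    ultimately show "eigenvalue ?A z"
      unfolding eigenvalue_def eigenvector_def dim by (intro exI[of _ ?w]) simp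
  qed
qed

lemma finite_eigenvalues_adjacency_matrix: "finite {cmod z |z. eigenvalue (adjacency_matrix V E) z \<and> P z}"
proof -
  have "finite (spectrum (adjacency_matrix V E))"
    using card_finite_spectrum(1)[of "adjacency_matrix V E" "card V"]
    by (simp add: adjacency_matrix_def)
  then have "finite (cmod ` spectrum (adjacency_matrix V E))" by simp
  then show ?thesis by (rule rev_finite_subset) (auto simp: spectrum_def)
qed

text \<open>Squaring turns both sides into (l/2 + 1)^2 \<le> n. A negative radicand is harmless:
  \<open>sqrt\<close> is negative there while \<open>l \<ge> 0\<close>.\<close>

lemma ramanujan_bound_iff:
  fixes l n :: real
  assumes "l \<ge> 0" "n \<ge> 0"
  shows "l \<le> 2 * sqrt (n - l - 1) \<longleftrightarrow> l \<le> 2 * (sqrt n - 1)"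
proof -
  have sq: "c \<le> sqrt y \<longleftrightarrow> c\<^sup>2 \<le> y" if "c \<ge> 0" for c y :: real
    using real_sqrt_le_iff[of "c\<^sup>2" y] that by simp
  have "l \<le> 2 * sqrt (n - l - 1) \<longleftrightarrow> l / 2 \<le> sqrt (n - l - 1)" by auto
  also have "\<dots> \<longleftrightarrow> (l / 2)\<^sup>2 \<le> n - l - 1" using assms by (intro sq) simp
  also have "\<dots> \<longleftrightarrow> (l / 2 + 1)\<^sup>2 \<le> n" by (simp add: power2_eq_square field_simps)
  also have "\<dots> \<longleftrightarrow> l / 2 + 1 \<le> sqrt n" using assms by (intro sq[symmetric]) simp
  also have "\<dots> \<longleftrightarrow> l \<le> 2 * (sqrt n - 1)" by auto
  finally show ?thesis .
qed

section \<open>Eigenvalues of Cayley graphs by passing to the complement\<close>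

context finite_group
begin

lemma card_cayley_neighbours:
  assumes "x \<in> carrier G" "S \<subseteq> carrier G"
  shows "card {y \<in> carrier G. cayley_adj G S x y} = card S"
proof -
  have "bij_betw (\<lambda>s. x \<otimes> s) S {y \<in> carrier G. cayley_adj G S x y}"
    using assms
    by (intro bij_betw_byWitness[where f' = "\<lambda>y. inv x \<otimes> y"])
      (auto simp: cayley_adj_def m_assoc[symmetric] subset_iff)
  then show ?thesis using bij_betw_same_card by metis
qed

lemma cayley_connected:
  assumes S: "S \<subseteq> carrier G" and gen: "generate G S = carrier G"
    and inv: "\<And>s. s \<in> S \<Longrightarrow> inv s \<in> S"
  shows "connected_graph (carrier G) (cayley_adj G S)"
proof -
  let ?R = "{(u, v). u \<in> carrier G \<and> v \<in> carrier G \<and> cayley_adj G S u v}"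
  have step: "(x, x \<otimes> s) \<in> ?R\<^sup>*" if "x \<in> carrier G" "s \<in> S" for x s
    using that S by (intro r_into_rtrancl) (auto simp: cayley_adj_def m_assoc[symmetric])
  have reach: "\<forall>x\<in>carrier G. (x, x \<otimes> g) \<in> ?R\<^sup>*" if "g \<in> generate G S" for g
    using that
  proof (induction rule: generate.induct)
    case one
    then show ?case by simp
  next
    case (incl s)
    then show ?case using step by blast
  next
    case (inv s)
    then show ?case using step assms(3) by blast
  next
    case (eng g g')
    show ?case
    proof
      fix x assume x: "x \<in> carrier G"
      have g: "g \<in> carrier G" "g' \<in> carrier G" using eng.hyps gen by auto
      have "(x, x \<otimes> g) \<in> ?R\<^sup>*" using eng.IH(1) x by blast
      moreover have "(x \<otimes> g, x \<otimes> g \<otimes> g') \<in> ?R\<^sup>*" using eng.IH(2) x g m_closed by blast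
      ultimately have "(x, x \<otimes> g \<otimes> g') \<in> ?R\<^sup>*" by (rule rtrancl_trans)
      then show "(x, x \<otimes> (g \<otimes> g')) \<in> ?R\<^sup>*" using x g by (simp only: m_assoc)
    qed
  qed
  have "(x, y) \<in> ?R\<^sup>*" if xy: "x \<in> carrier G" "y \<in> carrier G" for x y
  proof -
    have "(x, x \<otimes> (inv x \<otimes> y)) \<in> ?R\<^sup>*" using reach[of "inv x \<otimes> y"] xy gen by simp
    then show ?thesis using xy by (simp add: m_assoc[symmetric])
  qed
  then show ?thesis unfolding connected_graph_def by blast
qed

lemma cayley_simple:
  assumes "S \<subseteq> carrier G - {\<one>}" and "\<And>s. s \<in> S \<Longrightarrow> inv s \<in> S"
  shows "simple_graph (carrier G) (cayley_adj G S)"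
  unfolding simple_graph_def cayley_adj_def
proof (intro conjI ballI impI fin)
  fix x assume "x \<in> carrier G"
  then show "inv x \<otimes> x \<notin> S" using assms(1) by auto
next
  fix x y assume "x \<in> carrier G" "y \<in> carrier G" "inv x \<otimes> y \<in> S"
  then show "inv y \<otimes> x \<in> S" using assms(2)[of "inv x \<otimes> y"] by (simp add: inv_mult_group)
qed

lemma cayley_subsetD:
  assumes "cayley_subset G S"
  shows "S \<subseteq> carrier G - {\<one>}" "S \<subseteq> carrier G" "\<And>s. s \<in> S \<Longrightarrow> inv s \<in> S"
    "generate G S = carrier G"
  using assms by (auto simp: cayley_subset_def)

text \<open>The degree can only be \<open>card S\<close>. The first conjunct stems from the 0
  inserted in \<open>graph_mu\<close>; it fails exactly for empty \<open>S\<close>.\<close>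

lemma cayley_ramanujan_iff:
  assumes S: "cayley_subset G S"
  shows "ramanujan (carrier G) (cayley_adj G S) \<longleftrightarrow>
    0 \<le> 2 * sqrt (real (card S) - 1) \<and>
    (\<forall>z. eigenvalue (adjacency_matrix (carrier G) (cayley_adj G S)) z \<longrightarrow> cmod z \<noteq> real (card S) \<longrightarrow>
      cmod z \<le> 2 * sqrt (real (card S) - 1))"
proof -
  note S' = cayley_subsetD[OF S]
  have "regular_graph (carrier G) (cayley_adj G S) k \<longleftrightarrow> k = card S" for k
    unfolding regular_graph_def using card_cayley_neighbours[OF _ S'(2)] one_closed by auto
  then have "ramanujan (carrier G) (cayley_adj G S) \<longleftrightarrow>
      graph_mu (carrier G) (cayley_adj G S) (card S) \<le> 2 * sqrt (real (card S) - 1)"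
    unfolding ramanujan_def using cayley_simple[OF S'(1,3)] cayley_connected[OF S'(2,4,3)] by auto
  then show ?thesis
    unfolding graph_mu_def
    by (subst (asm) Max_le_iff) (auto simp: finite_eigenvalues_adjacency_matrix)
qed

text \<open>The adjacency operators of \<open>S\<close> and of its complement, loops included, add
  up to the all-ones operator.\<close>

lemma sum_neighbours:
  fixes f :: "'a \<Rightarrow> complex"
  assumes "x \<in> carrier G"
  shows "(\<Sum>y\<in>{y \<in> carrier G. cayley_adj G S x y}. f y)
    = (\<Sum>y\<in>carrier G. f y) - (\<Sum>y\<in>{y \<in> carrier G. cayley_adj G (carrier G - S) x y}. f y)"
proof -
  have "{y \<in> carrier G. cayley_adj G (carrier G - S) x y}
      = carrier G - {y \<in> carrier G. cayley_adj G S x y}"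
    using assms by (auto simp: cayley_adj_def)
  then show ?thesis using sum_diff[OF fin, of "{y \<in> carrier G. cayley_adj G S x y}" f] by simp
qed

text \<open>As \<open>S\<close> is closed under inverses, each vertex is a neighbour of exactly
  \<open>card S\<close> vertices. This forces eigenfunctions for eigenvalues other than
  \<open>card S\<close> to have sum 0.\<close>

lemma sum_over_neighbours:
  fixes f :: "'a \<Rightarrow> complex"
  assumes S: "S \<subseteq> carrier G" and inv: "\<And>s. s \<in> S \<Longrightarrow> inv s \<in> S"
  shows "(\<Sum>x\<in>carrier G. \<Sum>y\<in>{y \<in> carrier G. cayley_adj G S x y}. f y)
    = of_nat (card S) * (\<Sum>y\<in>carrier G. f y)"
proof -
  have sym: "cayley_adj G S x y \<longleftrightarrow> cayley_adj G S y x" if "x \<in> carrier G" "y \<in> carrier G" for x y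
    using inv[of "inv x \<otimes> y"] inv[of "inv y \<otimes> x"] that
    by (auto simp: cayley_adj_def inv_mult_group)
  have "(\<Sum>x\<in>carrier G. \<Sum>y\<in>{y \<in> carrier G. cayley_adj G S x y}. f y)
      = (\<Sum>y\<in>carrier G. \<Sum>x\<in>{x \<in> carrier G. cayley_adj G S x y}. f y)"
    by (rule sum.swap_restrict[OF fin fin])
  also have "\<dots> = (\<Sum>y\<in>carrier G. of_nat (card S) * f y)"
  proof (rule sum.cong)
    fix y assume y: "y \<in> carrier G"
    then have "{x \<in> carrier G. cayley_adj G S x y} = {x \<in> carrier G. cayley_adj G S y x}"
      using sym by blast
    then show "(\<Sum>x\<in>{x \<in> carrier G. cayley_adj G S x y}. f y) = of_nat (card S) * f y"
      using card_cayley_neighbours[OF y S] by simp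
  qed simp
  finally show ?thesis by (simp add: sum_distrib_left)
qed

text \<open>The eigenfunction has sum 0, so the operator of the complement multiplies it by
  \<open>- z\<close>. At a point where its modulus is largest, the triangle inequality bounds
  \<open>cmod z\<close> by the number of neighbours.\<close>

lemma cayley_eigenvalue_le:
  assumes S: "cayley_subset G S"
    and z: "eigenvalue (adjacency_matrix (carrier G) (cayley_adj G S)) z" "cmod z \<noteq> real (card S)"
  shows "cmod z \<le> real (card (carrier G - S))"
proof -
  note S' = cayley_subsetD[OF S]
  let ?C = "carrier G - S"
  obtain f a where f: "a \<in> carrier G" "f a \<noteq> 0"
    and eig: "\<And>x. x \<in> carrier G \<Longrightarrow> (\<Sum>y\<in>{y \<in> carrier G. cayley_adj G S x y}. f y) = z * f x"
    using z(1) unfolding eigenvalue_adjacency_matrix_iff[OF fin] by blast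
  have "of_nat (card S) * (\<Sum>y\<in>carrier G. f y) = z * (\<Sum>y\<in>carrier G. f y)"
    using sum_over_neighbours[OF S'(2,3), of f] eig by (simp add: sum_distrib_left)
  moreover have "z \<noteq> of_nat (card S)" using z(2) by auto
  ultimately have sum0: "(\<Sum>y\<in>carrier G. f y) = 0" by (metis mult_right_cancel)
  define M where "M = Max ((\<lambda>x. cmod (f x)) ` carrier G)"
  have M: "cmod (f y) \<le> M" if "y \<in> carrier G" for y
    unfolding M_def using that fin by (intro Max_ge) auto
  have "M \<in> (\<lambda>x. cmod (f x)) ` carrier G"
    unfolding M_def using fin by (intro Max_in) auto
  then obtain x where x: "x \<in> carrier G" "M = cmod (f x)" by auto
  have Mpos: "M > 0" using less_le_trans[of 0 "cmod (f a)" M] M[OF f(1)] f(2) by simp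
  have "z * f x = - (\<Sum>y\<in>{y \<in> carrier G. cayley_adj G ?C x y}. f y)"
    using eig[OF x(1)] sum_neighbours[OF x(1), where S = S and f = f] sum0 by simp
  from arg_cong[OF this, of cmod]
  have "cmod z * M = cmod (\<Sum>y\<in>{y \<in> carrier G. cayley_adj G ?C x y}. f y)"
    by (simp only: norm_minus_cancel norm_mult x(2))
  also have "\<dots> \<le> (\<Sum>y\<in>{y \<in> carrier G. cayley_adj G ?C x y}. M)"
    using M by (intro sum_norm_le) auto
  also have "\<dots> = real (card ?C) * M"
    using card_cayley_neighbours[OF x(1), of ?C] by simp
  finally show ?thesis using Mpos by simp
qed

lemma cayley_eigenvalue_of_complement_in_subgroup:
  assumes C: "carrier G - S \<subseteq> K" and K: "subgroup K G" "K \<noteq> carrier G"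
  shows "eigenvalue (adjacency_matrix (carrier G) (cayley_adj G S)) (- of_nat (card (carrier G - S)))"
proof -
  let ?C = "carrier G - S" and ?n = "card (carrier G)"
  have KG: "K \<subseteq> carrier G" using subgroup.subset[OF K(1)] .
  have n: "?n > 0" by (rule subgroup_card_pos[OF subgroup_self])
  have "card K < ?n" using KG K(2) fin by (intro psubset_card_mono) auto
  \<comment> \<open>The indicator of \<open>K\<close> minus its mean: it has sum 0 and is constant
    on left cosets of \<open>K\<close>, which adjacency along the complement never leaves.\<close>
  define f :: "'a \<Rightarrow> complex" where "f x = (if x \<in> K then 1 else 0) - of_nat (card K) / of_nat ?n" for x
  have "(\<Sum>y\<in>carrier G. f y) = (\<Sum>y\<in>carrier G. if y \<in> K then 1 else 0) - of_nat (card K)"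
    using n by (simp add: f_def sum_subtractf)
  also have "(\<Sum>y\<in>carrier G. if y \<in> K then 1 else 0) = (of_nat (card K) :: complex)"
    using KG fin by (simp add: sum.If_cases Int_absorb1)
  finally have sum0: "(\<Sum>y\<in>carrier G. f y) = 0" by simp
  have "(\<Sum>y\<in>{y \<in> carrier G. cayley_adj G S x y}. f y) = - of_nat (card ?C) * f x"
    if x: "x \<in> carrier G" for x
  proof -
    have "f y = f x" if y: "y \<in> carrier G" "cayley_adj G ?C x y" for y
    proof -
      have k: "inv x \<otimes> y \<in> K" using y C by (auto simp: cayley_adj_def)
      have yx: "x \<otimes> (inv x \<otimes> y) = y" using x y by (simp add: m_assoc[symmetric])
      have xy: "y \<otimes> inv (inv x \<otimes> y) = x"
        using x y by (simp add: inv_mult_group m_assoc[symmetric])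
      have "y \<in> K \<longleftrightarrow> x \<in> K"
        using subgroup.m_closed[OF K(1) _ k, of x] yx
          subgroup.m_closed[OF K(1) _ subgroup.m_inv_closed[OF K(1) k], of y] xy by auto
      then show ?thesis by (simp add: f_def)
    qed
    then have "(\<Sum>y\<in>{y \<in> carrier G. cayley_adj G ?C x y}. f y) = of_nat (card ?C) * f x"
      using card_cayley_neighbours[OF x, of ?C] by simp
    then show ?thesis using sum_neighbours[OF x, where S = S and f = f] sum0 by simp
  qed
  moreover have "f \<one> \<noteq> 0"
  proof -
    have "real (card K) \<noteq> real ?n" using \<open>card K < ?n\<close> by simp
    then have "(of_nat (card K) :: complex) \<noteq> of_nat ?n" by simp
    then show ?thesis using n subgroup.one_closed[OF K(1)] by (simp add: f_def)
  qed
  ultimately show ?thesis unfolding eigenvalue_adjacency_matrix_iff[OF fin] by blast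
qed

lemma card_complement:
  assumes "S \<subseteq> carrier G"
  shows "card S + card (carrier G - S) = card (carrier G)"
  using assms fin by (simp add: card_Diff_subset card_mono finite_subset)

lemma cayley_ramanujan_bound_iff:
  assumes "S \<subseteq> carrier G"
  shows "real (card (carrier G - S)) \<le> 2 * sqrt (real (card S) - 1) \<longleftrightarrow>
    real (card (carrier G - S)) \<le> 2 * (sqrt (real (card (carrier G))) - 1)"
proof -
  have "real (card S) - 1 = real (card (carrier G)) - real (card (carrier G - S)) - 1"
    using card_complement[OF assms] by linarith
  then show ?thesis
    using ramanujan_bound_iff[of "real (card (carrier G - S))" "real (card (carrier G))"] by simp
qed

lemma cayley_ramanujanI:
  assumes S: "cayley_subset G S"
    and l: "real (card (carrier G - S)) \<le> 2 * (sqrt (real (card (carrier G))) - 1)"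
  shows "ramanujan (carrier G) (cayley_adj G S)"
proof -
  have *: "real (card (carrier G - S)) \<le> 2 * sqrt (real (card S) - 1)"
    using l cayley_ramanujan_bound_iff[OF cayley_subsetD(2)[OF S]] by blast
  have "0 \<le> 2 * sqrt (real (card S) - 1)" using order_trans[OF _ *] by simp
  then show ?thesis
    unfolding cayley_ramanujan_iff[OF S] using cayley_eigenvalue_le[OF S] order_trans[OF _ *] by blast
qed

text \<open>By \<open>ne\<close>, the eigenvalue found in the previous construction differs in
  modulus from the degree \<open>card S\<close>; otherwise \<open>graph_mu\<close> would ignore
  it.\<close>

lemma cayley_ramanujanD:
  assumes S: "cayley_subset G S" and ram: "ramanujan (carrier G) (cayley_adj G S)"
    and K: "carrier G - S \<subseteq> K" "subgroup K G" "K \<noteq> carrier G"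
    and ne: "card (carrier G - S) \<noteq> card S"
  shows "real (card (carrier G - S)) \<le> 2 * (sqrt (real (card (carrier G))) - 1)"
proof -
  have "cmod (- of_nat (card (carrier G - S))) \<le> 2 * sqrt (real (card S) - 1)"
    using ram cayley_eigenvalue_of_complement_in_subgroup[OF K] ne
    unfolding cayley_ramanujan_iff[OF S] by auto
  then show ?thesis using cayley_ramanujan_bound_iff[OF cayley_subsetD(2)[OF S]] by simp
qed

section \<open>Conjugation-invariant sets and generation\<close>

lemma union_of_conj_classes_iff:
  "union_of_conj_classes G T \<longleftrightarrow>
    T \<subseteq> carrier G \<and> (\<forall>x\<in>T. \<forall>g\<in>carrier G. inv g \<otimes> x \<otimes> g \<in> T)"
proof
  assume "union_of_conj_classes G T"
  then obtain CC where CC: "CC \<subseteq> conj_class G ` carrier G" "T = \<Union>CC"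
    by (auto simp: union_of_conj_classes_def)
  show "T \<subseteq> carrier G \<and> (\<forall>x\<in>T. \<forall>g\<in>carrier G. inv g \<otimes> x \<otimes> g \<in> T)"
  proof (intro conjI ballI)
    show "T \<subseteq> carrier G" using CC by (auto simp: conj_class_def)
    fix x g assume x: "x \<in> T" and g: "g \<in> carrier G"
    then obtain C where C: "C \<in> CC" "x \<in> C" using CC by blast
    then obtain y where y: "y \<in> carrier G" "C = conj_class G y" using CC by blast
    then obtain k where k: "k \<in> carrier G" "x = inv k \<otimes> y \<otimes> k"
      using C(2) by (auto simp: conj_class_def)
    then have "inv g \<otimes> x \<otimes> g = inv (k \<otimes> g) \<otimes> y \<otimes> (k \<otimes> g)"
      using g y by (simp add: inv_mult_group m_assoc)
    moreover have "k \<otimes> g \<in> carrier G" using k g by simp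
    ultimately have "inv g \<otimes> x \<otimes> g \<in> C" unfolding y conj_class_def by blast
    then show "inv g \<otimes> x \<otimes> g \<in> T" using C CC by blast
  qed
next
  assume *: "T \<subseteq> carrier G \<and> (\<forall>x\<in>T. \<forall>g\<in>carrier G. inv g \<otimes> x \<otimes> g \<in> T)"
  have self: "x \<in> conj_class G x" if "x \<in> carrier G" for x
    using that by (auto simp: conj_class_def intro!: exI[of _ \<one>])
  have sub: "conj_class G x \<subseteq> T" if "x \<in> T" for x
    using * that by (auto simp: conj_class_def)
  have T: "T = \<Union>(conj_class G ` T)"
  proof
    show "T \<subseteq> \<Union>(conj_class G ` T)"
    proof
      fix x assume x: "x \<in> T"
      then have "x \<in> conj_class G x" using * self[of x] by blast
      then show "x \<in> \<Union>(conj_class G ` T)" by (rule UN_I[OF x])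
    qed
    show "\<Union>(conj_class G ` T) \<subseteq> T" by (rule UN_least) (rule sub)
  qed
  have "conj_class G ` T \<subseteq> conj_class G ` carrier G" using * by (intro image_mono) (rule conjunct1)
  with T show "union_of_conj_classes G T" unfolding union_of_conj_classes_def by (intro exI conjI)
qed

lemma conjugate_conjugate:
  assumes "x \<in> carrier G" "y \<in> carrier G" "z \<in> carrier G"
  shows "inv z \<otimes> (inv y \<otimes> x \<otimes> y) \<otimes> z = inv (y \<otimes> z) \<otimes> x \<otimes> (y \<otimes> z)"
  using assms by (simp add: inv_mult_group m_assoc)

lemma conjugate_back:
  assumes "x \<in> carrier G" "g \<in> carrier G"
  shows "inv (inv g) \<otimes> (inv g \<otimes> x \<otimes> g) \<otimes> inv g = x"
  using assms conjugate_conjugate[of x g "inv g"] by simp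

lemma union_of_conj_classes_complement:
  assumes "union_of_conj_classes G T"
  shows "union_of_conj_classes G (carrier G - T)"
  unfolding union_of_conj_classes_iff
proof (intro conjI ballI)
  fix x g assume x: "x \<in> carrier G - T" and g: "g \<in> carrier G"
  have "inv g \<otimes> x \<otimes> g \<notin> T"
  proof
    assume "inv g \<otimes> x \<otimes> g \<in> T"
    then have "inv (inv g) \<otimes> (inv g \<otimes> x \<otimes> g) \<otimes> inv g \<in> T"
      using assms g unfolding union_of_conj_classes_iff by blast
    then show False using x g conjugate_back by simp
  qed
  then show "inv g \<otimes> x \<otimes> g \<in> carrier G - T" using x g by simp
qed auto

text \<open>For \<open>x\<close> in \<open>K\<close> and \<open>g\<close> outside \<open>K\<close>,
  the product \<open>x \<otimes> g\<close> is outside \<open>K\<close>, and \<open>x\<close> is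
  recovered as \<open>(x \<otimes> g) \<otimes> inv g\<close>.\<close>

lemma generate_complement_of_subgroup:
  assumes K: "subgroup K G" "K \<noteq> carrier G" and S: "carrier G - K \<subseteq> S" "S \<subseteq> carrier G"
  shows "generate G S = carrier G"
proof
  show "generate G S \<subseteq> carrier G" using generate_incl[OF S(2)] .
  show "carrier G \<subseteq> generate G S"
  proof
    fix x assume x: "x \<in> carrier G"
    show "x \<in> generate G S"
    proof (cases "x \<in> K")
      case True
      obtain g where g: "g \<in> carrier G" "g \<notin> K" using K subgroup.subset[OF K(1)] by blast
      have "x \<otimes> g \<notin> K"
      proof
        assume "x \<otimes> g \<in> K"
        then have "inv x \<otimes> (x \<otimes> g) \<in> K"
          using subgroup.m_closed[OF K(1) subgroup.m_inv_closed[OF K(1) True]] by blast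
        then show False using x g by (simp add: m_assoc[symmetric])
      qed
      then have "x \<otimes> g \<in> S" "g \<in> S" using S x g by auto
      then have "(x \<otimes> g) \<otimes> inv g \<in> generate G S"
        by (intro generate.eng generate.incl generate.inv)
      then show ?thesis using x g by (simp add: m_assoc)
    next
      case False
      then show ?thesis using x S by (intro generate.incl) auto
    qed
  qed
qed

end

section \<open>Counting with the kernel; Cayley subsets with complement inside it\<close>

context malnormal
begin

lemma kernel_subset: "kernel \<subseteq> carrier G"
  by (auto simp: kernel_def)

lemma one_in_kernel: "\<one> \<in> kernel"
  by (simp add: kernel_def)

lemma kernel_union_of_conj_classes: "union_of_conj_classes G kernel"
  unfolding union_of_conj_classes_iff
proof (intro conjI ballI kernel_subset)
  fix x g assume x: "x \<in> kernel" and g: "g \<in> carrier G"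
  have xG: "x \<in> carrier G" using x kernel_subset by auto
  show "inv g \<otimes> x \<otimes> g \<in> kernel"
  proof (cases "x = \<one>")
    case True
    then show ?thesis using g by (simp add: kernel_def)
  next
    case False
    then have "\<forall>y\<in>carrier G. inv y \<otimes> x \<otimes> y \<notin> H" using x by (simp add: kernel_def)
    then have "inv (g \<otimes> y) \<otimes> x \<otimes> (g \<otimes> y) \<notin> H" if "y \<in> carrier G" for y
      using that g by blast
    then have "inv y \<otimes> (inv g \<otimes> x \<otimes> g) \<otimes> y \<notin> H" if "y \<in> carrier G" for y
      using that unfolding conjugate_conjugate[OF xG g that] by blast
    then show ?thesis unfolding kernel_def using xG g by blast
  qed
qed

lemma kernel_inv_closed:
  assumes x: "x \<in> kernel"
  shows "inv x \<in> kernel"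
proof (cases "x = \<one>")
  case True
  then show ?thesis using x by simp
next
  case False
  have xG: "x \<in> carrier G" using x kernel_subset by auto
  have "inv y \<otimes> inv x \<otimes> y \<notin> H" if y: "y \<in> carrier G" for y
  proof
    assume "inv y \<otimes> inv x \<otimes> y \<in> H"
    then have "inv (inv y \<otimes> inv x \<otimes> y) \<in> H" by (rule subgroup.m_inv_closed[OF sub])
    then have "inv y \<otimes> x \<otimes> y \<in> H" using xG y by (simp add: inv_mult_group m_assoc)
    then show False using x False y by (auto simp: kernel_def)
  qed
  then show ?thesis using xG by (auto simp: kernel_def)
qed

lemma conjugate_into_H:
  assumes "x \<in> carrier G - kernel"
  obtains w where "w \<in> carrier G" "inv w \<otimes> x \<otimes> w \<in> H" "inv w \<otimes> x \<otimes> w \<noteq> \<one>"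
proof -
  obtain w where w: "w \<in> carrier G" "inv w \<otimes> x \<otimes> w \<in> H" and x: "x \<noteq> \<one>" "x \<in> carrier G"
    using assms by (auto simp: kernel_def)
  have "inv w \<otimes> x \<otimes> w \<noteq> \<one>"
  proof
    assume "inv w \<otimes> x \<otimes> w = \<one>"
    then have "inv (inv w) \<otimes> \<one> \<otimes> inv w = x" using conjugate_back[OF x(2) w(1)] by simp
    then show False using w x by simp
  qed
  then show thesis using that w by blast
qed

text \<open>Double counting of the pairs \<open>(x, y)\<close> such that \<open>y\<inverse> x y\<close> lies in \<open>H\<close>.\<close>

lemma card_kernel_mult_card_H: "card kernel * card H = card (carrier G)"
proof -
  let ?n = "card (carrier G)"
  define F where "F x = {y \<in> carrier G. inv y \<otimes> x \<otimes> y \<in> H}" for x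
  have "(\<Sum>x\<in>carrier G. card (F x)) = (\<Sum>y\<in>carrier G. card {x \<in> carrier G. inv y \<otimes> x \<otimes> y \<in> H})"
    unfolding F_def using sum.swap_restrict[OF fin fin, of "\<lambda>_ _. 1::nat" "\<lambda>x y. inv y \<otimes> x \<otimes> y \<in> H"]
    by simp
  also have "\<dots> = (\<Sum>y\<in>carrier G. card H)"
  proof (rule sum.cong)
    fix y assume y: "y \<in> carrier G"
    have "bij_betw (\<lambda>x. inv y \<otimes> x \<otimes> y) {x \<in> carrier G. inv y \<otimes> x \<otimes> y \<in> H} H"
    proof (rule bij_betw_byWitness[where f' = "\<lambda>h. inv (inv y) \<otimes> h \<otimes> inv y"])
      show "\<forall>x\<in>{x \<in> carrier G. inv y \<otimes> x \<otimes> y \<in> H}.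
          inv (inv y) \<otimes> (inv y \<otimes> x \<otimes> y) \<otimes> inv y = x"
        using y conjugate_back by blast
      have unconj: "inv y \<otimes> (inv (inv y) \<otimes> h \<otimes> inv y) \<otimes> y = h" if "h \<in> carrier G" for h
        using conjugate_back[of h "inv y"] that y by simp
      then show "\<forall>h\<in>H. inv y \<otimes> (inv (inv y) \<otimes> h \<otimes> inv y) \<otimes> y = h"
        using H_subset by blast
      show "(\<lambda>x. inv y \<otimes> x \<otimes> y) ` {x \<in> carrier G. inv y \<otimes> x \<otimes> y \<in> H} \<subseteq> H" by auto
      have "inv (inv y) \<otimes> h \<otimes> inv y \<in> carrier G \<and> inv y \<otimes> (inv (inv y) \<otimes> h \<otimes> inv y) \<otimes> y \<in> H"
        if "h \<in> H" for h
      proof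
        have hG: "h \<in> carrier G" using that H_subset by blast
        then show "inv (inv y) \<otimes> h \<otimes> inv y \<in> carrier G" using y by simp
        show "inv y \<otimes> (inv (inv y) \<otimes> h \<otimes> inv y) \<otimes> y \<in> H" using unconj[OF hG] that by (simp only:)
      qed
      then show "(\<lambda>h. inv (inv y) \<otimes> h \<otimes> inv y) ` H \<subseteq> {x \<in> carrier G. inv y \<otimes> x \<otimes> y \<in> H}"
        by blast
    qed
    then show "card {x \<in> carrier G. inv y \<otimes> x \<otimes> y \<in> H} = card H" by (rule bij_betw_same_card)
  qed simp
  finally have total: "(\<Sum>x\<in>carrier G. card (F x)) = ?n * card H" by simp
  have one: "card (F \<one>) = ?n"
  proof -
    have "F \<one> = carrier G" using subgroup.one_closed[OF sub] by (auto simp: F_def)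
    then show ?thesis by simp
  qed
  have ker: "card (F x) = 0" if "x \<in> kernel - {\<one>}" for x
  proof -
    have "F x = {}" using that by (auto simp: F_def kernel_def)
    then show ?thesis by simp
  qed
  \<comment> \<open>By malnormality the admissible \<open>y\<close> form the left coset of
    \<open>H\<close> through \<open>w\<close>.\<close>
  have out: "card (F x) = card H" if x: "x \<in> carrier G - kernel" for x
  proof -
    have xG: "x \<in> carrier G" using x by simp
    obtain w where w: "w \<in> carrier G" "inv w \<otimes> x \<otimes> w \<in> H" "inv w \<otimes> x \<otimes> w \<noteq> \<one>"
      using conjugate_into_H[OF x] by blast
    have conj: "inv (w \<otimes> y) \<otimes> x \<otimes> (w \<otimes> y) = inv y \<otimes> (inv w \<otimes> x \<otimes> w) \<otimes> y"
      if "y \<in> carrier G" for y by (rule conjugate_conjugate[OF xG w(1) that, symmetric])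
    have "bij_betw (\<lambda>y. w \<otimes> y) H (F x)"
    proof (rule bij_betw_byWitness[where f' = "\<lambda>y. inv w \<otimes> y"])
      show "\<forall>y\<in>H. inv w \<otimes> (w \<otimes> y) = y"
        using H_subset w by (auto simp: m_assoc[symmetric])
      show "\<forall>y\<in>F x. w \<otimes> (inv w \<otimes> y) = y"
        using w by (auto simp: F_def m_assoc[symmetric])
      show "(\<lambda>y. w \<otimes> y) ` H \<subseteq> F x"
      proof (rule image_subsetI)
        fix y assume y: "y \<in> H"
        then have yG: "y \<in> carrier G" using H_subset by auto
        have "inv y \<otimes> (inv w \<otimes> x \<otimes> w) \<otimes> y \<in> H"
          by (rule subgroup.m_closed[OF sub subgroup.m_closed[OF sub
                subgroup.m_inv_closed[OF sub y] w(2)] y])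
        then show "w \<otimes> y \<in> F x" unfolding F_def using conj[OF yG] w yG by simp
      qed
      show "(\<lambda>y. inv w \<otimes> y) ` F x \<subseteq> H"
      proof (rule image_subsetI)
        fix y assume y: "y \<in> F x"
        then have yG: "y \<in> carrier G" "inv y \<otimes> x \<otimes> y \<in> H" by (auto simp: F_def)
        have "w \<otimes> (inv w \<otimes> y) = y" using w yG by (simp add: m_assoc[symmetric])
        then have "inv (inv w \<otimes> y) \<otimes> (inv w \<otimes> x \<otimes> w) \<otimes> (inv w \<otimes> y) \<in> H"
          using conj[of "inv w \<otimes> y"] w yG by simp
        then show "inv w \<otimes> y \<in> H" using malnormal[OF w(2,3), of "inv w \<otimes> y"] w yG by simp
      qed
    qed
    then show ?thesis using bij_betw_same_card by metis
  qed
  have fk: "finite kernel" using kernel_subset fin finite_subset by blast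
  have "(\<Sum>x\<in>carrier G. card (F x)) = (\<Sum>x\<in>carrier G - kernel. card (F x)) + (\<Sum>x\<in>kernel. card (F x))"
    by (rule sum.subset_diff[OF kernel_subset fin])
  also have "(\<Sum>x\<in>kernel. card (F x)) = card (F \<one>) + (\<Sum>x\<in>kernel - {\<one>}. card (F x))"
    by (rule sum.remove[OF fk one_in_kernel])
  finally have "?n * card H = card (carrier G - kernel) * card H + ?n"
    using total one ker out by simp
  moreover have "?n * card H = (card (carrier G - kernel) + card kernel) * card H"
    using card_complement[OF kernel_subset] by (simp add: add.commute)
  ultimately show ?thesis by (simp add: algebra_simps)
qed

text \<open>The centraliser of a nontrivial element of \<open>H\<close> lies in \<open>H\<close>, so that the fibres of
  \<open>y \<mapsto> y\<inverse> x y\<close> have at most \<open>card H\<close> elements.\<close>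

lemma card_conj_class_ge:
  assumes x: "x \<in> carrier G - kernel"
  shows "card kernel \<le> card (conj_class G x)"
proof -
  have xG: "x \<in> carrier G" using x by simp
  obtain w where w: "w \<in> carrier G" "inv w \<otimes> x \<otimes> w \<in> H" "inv w \<otimes> x \<otimes> w \<noteq> \<one>"
    using conjugate_into_H[OF x] by blast
  let ?C = "conj_class G x"
  have C: "?C = (\<lambda>y. inv y \<otimes> x \<otimes> y) ` carrier G" by (auto simp: conj_class_def)
  then have fC: "finite ?C" using fin by simp
  define F where "F z = {y \<in> carrier G. inv y \<otimes> x \<otimes> y = z}" for z
  have fibre: "card (F z) \<le> card H" if "z \<in> ?C" for z
  proof -
    from that obtain y0 where z: "z = inv y0 \<otimes> x \<otimes> y0" and y0: "y0 \<in> carrier G"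
      unfolding C by (rule imageE)
    \<comment> \<open>For \<open>y\<close> in the fibre, \<open>y \<otimes> inv y0\<close>
      centralises \<open>x\<close>; conjugation by \<open>w\<close> moves it into the centraliser of
      an element of \<open>H\<close> other than \<open>\<one>\<close>.\<close>
    have "(\<lambda>y. inv w \<otimes> (y \<otimes> inv y0) \<otimes> w) ` F z \<subseteq> H"
    proof (rule image_subsetI)
      fix y assume "y \<in> F z"
      then have y: "y \<in> carrier G" "inv y \<otimes> x \<otimes> y = inv y0 \<otimes> x \<otimes> y0"
        unfolding F_def z by simp_all
      let ?g = "inv w \<otimes> (y \<otimes> inv y0) \<otimes> w"
      have wg: "w \<otimes> ?g = y \<otimes> inv y0 \<otimes> w"
      proof -
        have "w \<otimes> ?g = (w \<otimes> inv w) \<otimes> (y \<otimes> inv y0 \<otimes> w)"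
          using w(1) y(1) y0 by (simp only: m_assoc inv_closed m_closed)
        then show ?thesis using w(1) y(1) y0 by simp
      qed
      have gG: "?g \<in> carrier G" using w(1) y(1) y0 by simp
      have "inv ?g \<otimes> (inv w \<otimes> x \<otimes> w) \<otimes> ?g = inv (w \<otimes> ?g) \<otimes> x \<otimes> (w \<otimes> ?g)"
        by (rule conjugate_conjugate[OF xG w(1) gG])
      also have "\<dots> = inv (y \<otimes> (inv y0 \<otimes> w)) \<otimes> x \<otimes> (y \<otimes> (inv y0 \<otimes> w))"
        unfolding wg using w(1) y(1) y0 by (simp only: m_assoc inv_closed m_closed)
      also have "\<dots> = inv (inv y0 \<otimes> w) \<otimes> (inv y \<otimes> x \<otimes> y) \<otimes> (inv y0 \<otimes> w)"
        using w(1) y(1) y0 xG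
        by (intro conjugate_conjugate[symmetric]) (simp_all only: inv_closed m_closed)
      also have "\<dots> = inv w \<otimes> (inv (inv y0) \<otimes> (inv y0 \<otimes> x \<otimes> y0) \<otimes> inv y0) \<otimes> w"
        unfolding y(2) using w(1) y0 xG
        by (intro conjugate_conjugate[symmetric]) (simp_all only: inv_closed m_closed)
      also have "\<dots> = inv w \<otimes> x \<otimes> w"
        by (simp only: conjugate_back[OF xG y0])
      finally have "inv ?g \<otimes> (inv w \<otimes> x \<otimes> w) \<otimes> ?g \<in> H" using w(2) by (simp only:)
      then show "?g \<in> H" by (rule malnormal[OF w(2,3) gG])
    qed
    moreover have "inj_on (\<lambda>y. inv w \<otimes> (y \<otimes> inv y0) \<otimes> w) (F z)"
    proof (rule inj_onI)
      fix a b assume "a \<in> F z" "b \<in> F z"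
      then have "a \<in> carrier G" "b \<in> carrier G" by (simp_all add: F_def)
      moreover assume "inv w \<otimes> (a \<otimes> inv y0) \<otimes> w = inv w \<otimes> (b \<otimes> inv y0) \<otimes> w"
      ultimately show "a = b" using w(1) y0 by simp
    qed
    ultimately show ?thesis using finite_H card_inj_on_le by blast
  qed
  have "card (carrier G) = card (\<Union>z\<in>?C. F z)"
    unfolding C F_def by (rule arg_cong[of _ _ card]) blast
  also have "\<dots> \<le> (\<Sum>z\<in>?C. card (F z))" by (rule card_UN_le[OF fC])
  also have "\<dots> \<le> (\<Sum>z\<in>?C. card H)" using fibre by (rule sum_mono)
  finally have "card kernel * card H \<le> card ?C * card H"
    by (simp add: card_kernel_mult_card_H)
  then show ?thesis using subgroup_card_pos[OF sub] by simp
qed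

text \<open>Besides a class outside the kernel, the complement would contain \<open>\<one>\<close>,
  hence more than \<open>card kernel\<close> elements. The extra element is why equality is allowed
  in \<open>small\<close>.\<close>

lemma complement_subset_kernel:
  assumes S: "S \<in> normal_cayley_subsets G" and small: "card (carrier G - S) \<le> card kernel"
  shows "carrier G - S \<subseteq> kernel"
proof
  fix x assume x: "x \<in> carrier G - S"
  have Sc: "cayley_subset G S" and Su: "union_of_conj_classes G S"
    using S by (auto simp: normal_cayley_subsets_def)
  show "x \<in> kernel"
  proof (rule ccontr)
    assume xk: "x \<notin> kernel"
    have "conj_class G x \<subseteq> carrier G - S"
      using union_of_conj_classes_complement[OF Su] x
      unfolding union_of_conj_classes_iff by (auto simp: conj_class_def)
    moreover have "\<one> \<in> carrier G - S" using cayley_subsetD(1)[OF Sc] by auto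
    moreover have "\<one> \<notin> conj_class G x"
    proof
      assume "\<one> \<in> conj_class G x"
      then obtain g where g: "g \<in> carrier G" "inv g \<otimes> x \<otimes> g = \<one>" by (auto simp: conj_class_def)
      then have "x = \<one>" using conjugate_back[of x g] x by simp
      then show False using xk one_in_kernel by simp
    qed
    ultimately have "insert \<one> (conj_class G x) \<subseteq> carrier G - S" "card (insert \<one> (conj_class G x)) = Suc (card (conj_class G x))"
      using fin finite_subset[of "conj_class G x" "carrier G - S"] by auto
    then have "Suc (card (conj_class G x)) \<le> card (carrier G - S)"
      using fin by (metis card_mono finite_Diff)
    then show False using small card_conj_class_ge[of x] x xk by simp
  qed
qed

text \<open>Generation is the point that uses Frobenius' theorem: the kernel lies in a proper
  subgroup, so the set contains everything outside that subgroup.\<close>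

lemma normal_cayley_of_kernel_part:
  assumes T: "T \<subseteq> kernel - {\<one>}" "union_of_conj_classes G T" "\<And>x. x \<in> T \<Longrightarrow> inv x \<in> T"
  shows "(carrier G - kernel) \<union> T \<in> normal_cayley_subsets G"
proof -
  obtain K where K: "subgroup K G" "kernel \<subseteq> K" "K \<noteq> carrier G"
    using kernel_in_proper_subgroup by blast
  let ?S = "(carrier G - kernel) \<union> T"
  have SG: "?S \<subseteq> carrier G" using T kernel_subset by auto
  have inv: "inv x \<in> ?S" if "x \<in> ?S" for x
  proof (cases "x \<in> T")
    case False
    then have "x \<in> carrier G" "x \<notin> kernel" using that by auto
    then show ?thesis using kernel_inv_closed[of "inv x"] by auto
  qed (use T in auto)
  have "?S = (\<lambda>x. inv x) ` ?S"
  proof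
    show "?S \<subseteq> (\<lambda>x. inv x) ` ?S"
    proof
      fix x assume x: "x \<in> ?S"
      then have "x = inv (inv x)" using SG by auto
      then show "x \<in> (\<lambda>x. inv x) ` ?S" using inv[OF x] by blast
    qed
  qed (use inv in blast)
  moreover have "generate G ?S = carrier G"
    using K SG by (intro generate_complement_of_subgroup[OF K(1,3)]) auto
  moreover have "?S \<subseteq> carrier G - {\<one>}" using SG T one_in_kernel by auto
  moreover have "union_of_conj_classes G ?S"
    using union_of_conj_classes_complement[OF kernel_union_of_conj_classes] T(2)
    unfolding union_of_conj_classes_iff by blast
  ultimately show ?thesis by (simp add: normal_cayley_subsets_def cayley_subset_def)
qed

lemma card_complement_of_kernel_part:
  assumes "T \<subseteq> kernel"
  shows "carrier G - ((carrier G - kernel) \<union> T) = kernel - T"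
    "card (carrier G - ((carrier G - kernel) \<union> T)) = card kernel - card T"
proof -
  show *: "carrier G - ((carrier G - kernel) \<union> T) = kernel - T" using kernel_subset by blast
  have "finite T" by (rule finite_subset[OF subset_trans[OF assms kernel_subset] fin])
  then show "card (carrier G - ((carrier G - kernel) \<union> T)) = card kernel - card T"
    unfolding * using assms by (rule card_Diff_subset)
qed

end

section \<open>Normal Cayley graphs of Frobenius groups\<close>

lemma frobenius_group_malnormal:
  assumes "frobenius_group G H"
  shows "malnormal G H"
proof -
  have G: "group G" "finite (carrier G)" "subgroup H G" "H \<noteq> {\<one>\<^bsub>G\<^esub>}"
    and TI: "\<And>g. g \<in> carrier G - H \<Longrightarrow> H \<inter> conj_set G H g = {\<one>\<^bsub>G\<^esub>}"
    using assms by (auto simp: frobenius_group_def)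
  interpret finite_group G using G by (intro finite_group.intro finite_group_axioms.intro)
  show ?thesis
  proof (intro malnormal.intro malnormal_axioms.intro)
    show "finite_group G" by (rule finite_group_axioms)
    show "subgroup H G" by (fact G)
    show "H \<noteq> {\<one>\<^bsub>G\<^esub>}" by (fact G)
    fix x y assume x: "x \<in> H" "x \<noteq> \<one>\<^bsub>G\<^esub>" and y: "y \<in> carrier G"
      and xy: "inv\<^bsub>G\<^esub> y \<otimes>\<^bsub>G\<^esub> x \<otimes>\<^bsub>G\<^esub> y \<in> H"
    have xG: "x \<in> carrier G" using x(1) subgroup.subset[OF G(3)] by blast
    show "y \<in> H"
    proof (rule ccontr)
      assume "y \<notin> H"
      moreover have "inv\<^bsub>G\<^esub> y \<otimes>\<^bsub>G\<^esub> x \<otimes>\<^bsub>G\<^esub> y \<in> conj_set G H y"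
        unfolding conj_set_def using x(1) by (rule imageI)
      ultimately have one: "inv\<^bsub>G\<^esub> y \<otimes>\<^bsub>G\<^esub> x \<otimes>\<^bsub>G\<^esub> y = \<one>\<^bsub>G\<^esub>" using TI[of y] y xy by auto
      show False using conjugate_back[OF xG y] x(2) y unfolding one by simp
    qed
  qed
qed

context malnormal
begin

lemma kernel_eq_frobenius_kernel: "kernel = frobenius_kernel G H"
proof -
  have "x \<in> (\<Union>g\<in>carrier G. conj_set G H g) \<longleftrightarrow> (\<exists>y\<in>carrier G. inv y \<otimes> x \<otimes> y \<in> H)"
    if x: "x \<in> carrier G" for x
  proof
    assume "x \<in> (\<Union>g\<in>carrier G. conj_set G H g)"
    then obtain g k where g: "g \<in> carrier G" "k \<in> H" "x = inv g \<otimes> k \<otimes> g"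
      by (auto simp: conj_set_def)
    then have "inv (inv g) \<otimes> x \<otimes> inv g = k" using conjugate_back[of k g] H_subset by auto
    then show "\<exists>y\<in>carrier G. inv y \<otimes> x \<otimes> y \<in> H" using g by (intro bexI[of _ "inv g"]) auto
  next
    assume "\<exists>y\<in>carrier G. inv y \<otimes> x \<otimes> y \<in> H"
    then obtain y where y: "y \<in> carrier G" "inv y \<otimes> x \<otimes> y \<in> H" by blast
    have "x \<in> conj_set G H (inv y)"
      unfolding conj_set_def using conjugate_back[OF x y(1)] y(2) by (intro image_eqI) auto
    then show "x \<in> (\<Union>g\<in>carrier G. conj_set G H g)" using y(1) by (intro UN_I[of "inv y"]) auto
  qed
  then show ?thesis unfolding kernel_def frobenius_kernel_def by auto
qed

lemma kernel_minus_one_union_of_conj_classes: "union_of_conj_classes G (kernel - {\<one>})"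
  unfolding union_of_conj_classes_iff
proof (intro conjI ballI)
  fix x g assume x: "x \<in> kernel - {\<one>}" and g: "g \<in> carrier G"
  have xG: "x \<in> carrier G" using x kernel_subset by auto
  have "inv g \<otimes> x \<otimes> g \<in> kernel"
    using kernel_union_of_conj_classes x g unfolding union_of_conj_classes_iff by blast
  moreover have "inv g \<otimes> x \<otimes> g \<noteq> \<one>"
  proof
    assume one: "inv g \<otimes> x \<otimes> g = \<one>"
    show False using conjugate_back[OF xG g] x g unfolding one by simp
  qed
  ultimately show "inv g \<otimes> x \<otimes> g \<in> kernel - {\<one>}" by blast
qed (use kernel_subset in auto)

text \<open>If \<open>H\<close> has order 2, then the kernel has index 2 and every element outside it is an
  involution, which forces such elements to invert the kernel by conjugation.\<close>

lemma inverse_pair_union_of_conj_classes: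
  assumes card: "card H = 2" and x: "x \<in> kernel"
  shows "union_of_conj_classes G {x, inv x}"
proof -
  obtain K where K: "subgroup K G" "kernel \<subseteq> K" "K \<noteq> carrier G"
    using kernel_in_proper_subgroup by blast
  have KG: "K \<subseteq> carrier G" by (rule subgroup.subset[OF K(1)])
  have fK: "finite K" by (rule finite_subset[OF KG fin])
  \<comment> \<open>By counting, the kernel has half the elements of \<open>G\<close>, and a proper
    subgroup cannot have more.\<close>
  have "kernel = K"
  proof (rule card_subset_eq[OF fK K(2)])
    have "card K dvd card (carrier G)"
      using lagrange[OF K(1)] unfolding Coset.order_def by (metis dvd_triv_right)
    then obtain q where q: "card (carrier G) = card K * q" by (rule dvdE)
    have "card K < card (carrier G)" using KG K(3) fin by (intro psubset_card_mono) auto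
    then have "q \<ge> 2" using q by (cases q; cases "q - 1") auto
    then have "card K * 2 \<le> card kernel * 2" using card_kernel_mult_card_H card q by (metis mult_le_mono2)
    then show "card kernel = card K" using card_mono[OF fK K(2)] by simp
  qed
  then have ker: "subgroup kernel G" using K(1) by simp
  obtain t where t: "H = {\<one>, t}" "t \<noteq> \<one>"
  proof -
    obtain a b where ab: "H = {a, b}" "a \<noteq> b" using card by (auto simp: card_2_iff)
    then show thesis using that subgroup.one_closed[OF sub] by (cases "a = \<one>") (auto simp: insert_commute)
  qed
  have tG: "t \<in> carrier G" using t(1) H_subset by auto
  have tt: "t \<otimes> t = \<one>"
  proof -
    have "t \<otimes> t \<in> {\<one>, t}" using subgroup.m_closed[OF sub, of t t] unfolding t(1) by simp
    moreover have "t \<otimes> t \<noteq> t" using tG t(2) by simp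
    ultimately show ?thesis by simp
  qed
  have invol: "y \<otimes> y = \<one>" if y: "y \<in> carrier G - kernel" for y
  proof -
    have yG: "y \<in> carrier G" using y by simp
    obtain w where w: "w \<in> carrier G" "inv w \<otimes> y \<otimes> w \<in> H" "inv w \<otimes> y \<otimes> w \<noteq> \<one>"
      using conjugate_into_H[OF y] by blast
    then have "inv w \<otimes> y \<otimes> w = t" using t(1) by simp
    then have y': "y = inv (inv w) \<otimes> t \<otimes> inv w" using conjugate_back[OF yG w(1)] by simp
    have "y \<otimes> y = w \<otimes> t \<otimes> (inv w \<otimes> w) \<otimes> t \<otimes> inv w"
      unfolding y' using w(1) tG by (simp only: inv_inv m_assoc inv_closed m_closed)
    also have "\<dots> = w \<otimes> (t \<otimes> t) \<otimes> inv w"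
      using w(1) tG by (simp add: m_assoc)
    finally show ?thesis using w(1) by (simp add: tt)
  qed
  have outside: "k \<otimes> g \<in> carrier G - kernel" if k: "k \<in> kernel" and g: "g \<in> carrier G - kernel" for k g
  proof -
    have kG: "k \<in> carrier G" "g \<in> carrier G" using k g kernel_subset by auto
    have "k \<otimes> g \<notin> kernel"
    proof
      assume "k \<otimes> g \<in> kernel"
      then have "inv k \<otimes> (k \<otimes> g) \<in> kernel"
        using subgroup.m_closed[OF ker subgroup.m_inv_closed[OF ker k]] by blast
      then show False using g kG by (simp add: m_assoc[symmetric])
    qed
    then show ?thesis using kG by simp
  qed
  \<comment> \<open>Both \<open>g\<close> and \<open>k \<otimes> g\<close> lie outside the kernel
    and are involutions; the square of the latter gives the claim.\<close>
  have inverts: "inv g \<otimes> k \<otimes> g = inv k" if k: "k \<in> kernel" and g: "g \<in> carrier G - kernel" for k g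
  proof -
    have kG: "k \<in> carrier G" "g \<in> carrier G" using k g kernel_subset by auto
    have "inv g = g" using inv_equality[OF invol[OF g]] kG by simp
    moreover have "g \<otimes> k \<otimes> g = inv k"
    proof -
      have "k \<otimes> (g \<otimes> k \<otimes> g) = \<one>" using invol[OF outside[OF k g]] kG by (simp add: m_assoc)
      then show ?thesis using kG inv_equality[of "g \<otimes> k \<otimes> g" k] inv_comm by (simp add: inv_comm)
    qed
    ultimately show ?thesis by simp
  qed
  \<comment> \<open>Both \<open>t\<close> and \<open>t \<otimes> g\<close> invert the kernel, so
    \<open>g\<close> acts trivially on it: the kernel is abelian.\<close>
  have fixes_kernel: "inv g \<otimes> k \<otimes> g = k" if k: "k \<in> kernel" and g: "g \<in> kernel" for k g
  proof -
    have kG: "k \<in> carrier G" "g \<in> carrier G" using k g kernel_subset by auto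
    have tk: "t \<in> carrier G - kernel"
    proof -
      have "inv \<one> \<otimes> t \<otimes> \<one> \<in> H" using t(1) tG by simp
      then show ?thesis using tG t(2) one_closed unfolding kernel_def by blast
    qed
    have "inv g \<otimes> (inv t \<otimes> inv k \<otimes> t) \<otimes> g = inv (t \<otimes> g) \<otimes> inv k \<otimes> (t \<otimes> g)"
      using kG tG by (intro conjugate_conjugate) simp_all
    also have "\<dots> = inv (inv k)"
    proof (rule inverts)
      show "inv k \<in> kernel" by (rule kernel_inv_closed[OF k])
      have "t \<otimes> g \<notin> kernel"
      proof
        assume "t \<otimes> g \<in> kernel"
        then have "t \<otimes> g \<otimes> inv g \<in> kernel"
          using subgroup.m_closed[OF ker _ subgroup.m_inv_closed[OF ker g]] by blast
        then show False using tk kG tG by (simp add: m_assoc)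
      qed
      then show "t \<otimes> g \<in> carrier G - kernel" using kG tG by simp
    qed
    finally show ?thesis using inverts[OF kernel_inv_closed[OF k] tk] kG by simp
  qed
  have xG: "x \<in> carrier G" using x kernel_subset by auto
  show ?thesis
    unfolding union_of_conj_classes_iff
  proof (intro conjI ballI)
    show "{x, inv x} \<subseteq> carrier G" using xG by simp
    fix y g assume y: "y \<in> {x, inv x}" and g: "g \<in> carrier G"
    have yk: "y \<in> kernel" using y x kernel_inv_closed by auto
    have "inv y \<in> {x, inv x}" using y xG by auto
    then show "inv g \<otimes> y \<otimes> g \<in> {x, inv x}"
      using y inverts[OF yk, of g] fixes_kernel[OF yk, of g] g by (cases "g \<in> kernel") simp_all
  qed
qed

end

section \<open>Comparison of the two maxima\<close>

theorem theorem3p3: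
  fixes G :: "('a, 'b) monoid_scheme"
    and H N :: "'a set"
    and r :: real
    and S0 :: "'a set set"
    and L :: "nat set"
    and l0 lhat :: nat
    and A :: "real set"
  assumes "frobenius_group G H"
    and "N = frobenius_kernel G H"
    and "r = (real (card N) - 1) / real (card H)"
    and "S0 = normal_cayley_subsets G"
    and "L = {card (carrier G) - card S | S. S \<in> S0}"
    and "l0 = Max {l \<in> L. real l \<le> 2 * (sqrt (real (card (carrier G))) - 1)}"
    and "lhat = Max {l \<in> L. \<forall>S \<in> S0.
           1 \<le> card (carrier G) - card S \<and> card (carrier G) - card S \<le> l \<longrightarrow>
           ramanujan (carrier G) (cayley_adj G S)}"
    and "A = {(real (card N) - 1 - real (card T)) / real (card H) | T.
           T \<subseteq> N - {\<one>\<^bsub>G\<^esub>} \<and> union_of_conj_classes G T \<and> (\<forall>x \<in> T. inv\<^bsub>G\<^esub> x \<in> T)}"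
    and "r \<ge> 4"
  shows "(l0 < card N \<and> (\<exists>a \<in> A. a < r \<and> real l0 = 1 + a * real (card H))) \<and> lhat = l0"
proof -
  interpret malnormal G H by (rule frobenius_group_malnormal[OF assms(1)])
  have N: "N = kernel" using assms(2) kernel_eq_frobenius_kernel by simp
  let ?n = "card (carrier G)" and ?m = "card kernel" and ?h = "card H"
  define B where "B = 2 * (sqrt (real ?n) - 1)"
  have finite_kernel: "finite kernel" by (rule finite_subset[OF kernel_subset fin])
  have hpos: "?h > 0" by (rule subgroup_card_pos[OF sub])
  have h2: "?h \<ge> 2"
  proof (rule ccontr)
    assume "\<not> ?h \<ge> 2"
    then have "?h = 1" using hpos by simp
    then show False using nontrivial subgroup.one_closed[OF sub] by (auto simp: card_1_singleton_iff)
  qed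
  have mn: "?m * ?h = ?n" by (rule card_kernel_mult_card_H)
  have "4 * real ?h \<le> real ?m - 1"
    using assms(9) hpos unfolding assms(3) N by (simp add: pos_le_divide_eq)
  then have m4: "4 * ?h + 1 \<le> ?m" by linarith
  \<comment> \<open>From 4h < m follows 4n < m^2. The margin 2 leaves room for deleting a pair of
    inverse elements from the kernel below.\<close>
  have Bm: "B < real ?m - 2"
  proof -
    have "4 * ?n < ?m * ?m" using m4 unfolding mn[symmetric] by simp
    then have "4 * real ?n < (real ?m)\<^sup>2"
      unfolding power2_eq_square by (metis of_nat_less_iff of_nat_mult of_nat_numeral)
    then have "sqrt (4 * real ?n) < real ?m" by (intro real_less_lsqrt) auto
    then show ?thesis by (simp add: B_def real_sqrt_mult)
  qed
  have B1: "1 \<le> B"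
  proof -
    have "9 * 2 \<le> ?m * ?h" using m4 h2 by (intro mult_le_mono) auto
    then have "9 \<le> real ?n" using mn by linarith
    then have "3 \<le> sqrt (real ?n)" by (intro real_le_rsqrt) simp
    then show ?thesis by (simp add: B_def)
  qed
  have cayley: "cayley_subset G S" "union_of_conj_classes G S" "S \<subseteq> carrier G" if "S \<in> S0" for S
    using that cayley_subsetD(2) unfolding assms(4) normal_cayley_subsets_def by auto
  have card_diff: "?n - card S = card (carrier G - S)" if "S \<in> S0" for S
    using card_complement[OF cayley(3)[OF that]] by simp
  have "L = (\<lambda>S. ?n - card S) ` S0" unfolding assms(5) by auto
  also have "\<dots> = (\<lambda>S. card (carrier G - S)) ` S0" by (rule image_cong[OF refl card_diff])
  finally have L: "l \<in> L \<longleftrightarrow> (\<exists>S\<in>S0. l = card (carrier G - S))" for l by blast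
  have "L \<subseteq> {..?n}" unfolding assms(5) by auto
  then have finL: "finite L" by (rule finite_subset) simp
  \<comment> \<open>Witnessed by the set of all elements other than \<open>\<one>\<close>; it makes
    the set whose maximum is \<open>l0\<close> nonempty.\<close>
  have oneL: "1 \<in> L"
  proof -
    let ?S = "(carrier G - kernel) \<union> (kernel - {\<one>\<^bsub>G\<^esub>})"
    have "inv\<^bsub>G\<^esub> x \<in> kernel - {\<one>\<^bsub>G\<^esub>}" if "x \<in> kernel - {\<one>\<^bsub>G\<^esub>}" for x
      using that kernel_inv_closed kernel_subset by auto
    then have "?S \<in> S0"
      unfolding assms(4)
      by (intro normal_cayley_of_kernel_part kernel_minus_one_union_of_conj_classes order_refl)
    moreover have "carrier G - ?S = {\<one>\<^bsub>G\<^esub>}"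
      using one_in_kernel by (subst card_complement_of_kernel_part(1)) auto
    ultimately show ?thesis unfolding L by (intro bexI[of _ ?S]) simp_all
  qed
  let ?L0 = "{l \<in> L. real l \<le> B}"
  have fin0: "finite ?L0" using finL by simp
  have l0: "l0 = Max ?L0" using assms(6) unfolding B_def .
  have one0: "1 \<in> ?L0" using oneL B1 by simp
  have "l0 \<in> ?L0" unfolding l0 using fin0 one0 by (intro Max_in) auto
  then have l0L: "l0 \<in> L" and l0B: "real l0 \<le> B" by auto
  have l0max: "l \<le> l0" if "l \<in> L" "real l \<le> B" for l
    unfolding l0 using fin0 that by (intro Max_ge) auto
  have l01: "1 \<le> l0" using l0max[OF oneL] B1 by simp
  have l0m: "l0 < ?m" using l0B Bm by linarith

  have part1: "\<exists>a\<in>A. a < r \<and> real l0 = 1 + a * real ?h"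
  proof -
    obtain S where S: "S \<in> S0" "l0 = card (carrier G - S)" using l0L unfolding L by blast
    have Sn: "S \<in> normal_cayley_subsets G" using S(1) assms(4) by simp
    have Ck: "carrier G - S \<subseteq> kernel"
      using complement_subset_kernel[OF Sn] l0m S(2) by simp
    \<comment> \<open>The complement of \<open>S\<close> is then \<open>kernel - T\<close>, so
      \<open>l0\<close> is \<open>card kernel\<close> minus \<open>card T\<close>.\<close>
    define T where "T = S \<inter> kernel"
    have T1: "T \<subseteq> N - {\<one>\<^bsub>G\<^esub>}"
      using cayley_subsetD(1)[OF cayley(1)[OF S(1)]] unfolding T_def N by auto
    have T2: "union_of_conj_classes G T"
      using cayley(2)[OF S(1)] kernel_union_of_conj_classes
      unfolding union_of_conj_classes_iff T_def by blast
    have T3: "\<forall>x\<in>T. inv\<^bsub>G\<^esub> x \<in> T"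
      using cayley_subsetD(3)[OF cayley(1)[OF S(1)]] kernel_inv_closed unfolding T_def by blast
    have "carrier G - S = kernel - T" using Ck kernel_subset unfolding T_def by blast
    moreover have Tk: "T \<subseteq> kernel" unfolding T_def by blast
    ultimately have "card (carrier G - S) = ?m - card T"
      using finite_subset[OF Tk finite_kernel] by (simp add: card_Diff_subset)
    then have l0T: "real l0 = real ?m - real (card T)"
      using S(2) card_mono[OF finite_kernel Tk] by simp
    define a where "a = (real (card N) - 1 - real (card T)) / real ?h"
    have "a \<in> A" unfolding assms(8) a_def using T1 T2 T3 by blast
    moreover have ah: "a * real ?h = real l0 - 1" using hpos by (simp add: a_def N l0T)
    moreover have "a < r"
    proof -
      have "real (card N) - 1 - real (card T) < real (card N) - 1" using l0T l0m unfolding N by linarith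
      then show ?thesis unfolding a_def assms(3) using hpos by (intro divide_strict_right_mono) auto
    qed
    ultimately show ?thesis by (intro bexI[of _ a]) auto
  qed

  obtain K where K: "subgroup K G" "kernel \<subseteq> K" "K \<noteq> carrier G"
    using kernel_in_proper_subgroup by blast
  have not_ram: "\<not> ramanujan (carrier G) (cayley_adj G S)"
    if S: "S \<in> S0" and C: "carrier G - S \<subseteq> kernel" and big: "real (card (carrier G - S)) > B"
      and ne: "card (carrier G - S) \<noteq> card S" for S
    using cayley_ramanujanD[OF cayley(1)[OF S] _ subset_trans[OF C K(2)] K(1,3) ne] big
    unfolding B_def by linarith
  have small_ne: "card (carrier G - S) \<noteq> card S" if S: "S \<in> S0" and "card (carrier G - S) < ?m" for S
  proof -
    have "?m * 2 \<le> ?n" unfolding mn[symmetric] using h2 by simp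
    then show ?thesis using card_complement[OF cayley(3)[OF S]] that(2) by linarith
  qed
  let ?good = "\<lambda>l. \<forall>S\<in>S0. 1 \<le> ?n - card S \<and> ?n - card S \<le> l \<longrightarrow>
    ramanujan (carrier G) (cayley_adj G S)"
  have good: "?good l0"
  proof (intro ballI impI)
    fix S assume S: "S \<in> S0" and le: "1 \<le> ?n - card S \<and> ?n - card S \<le> l0"
    have "real (card (carrier G - S)) \<le> B" using le l0B unfolding card_diff[OF S] by linarith
    then show "ramanujan (carrier G) (cayley_adj G S)"
      unfolding B_def by (rule cayley_ramanujanI[OF cayley(1)[OF S]])
  qed
  have bad: "l \<le> l0" if lL: "l \<in> L" and gl: "?good l" for l
  proof (rule ccontr)
    assume "\<not> l \<le> l0"
    then have l_gt: "l0 < l" and lB: "real l > B" using l0max[OF lL] by force+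
    \<comment> \<open>To refute \<open>?good l\<close>, any complement inside the kernel of size
      above \<open>B\<close> and at most \<open>l\<close> will do. For \<open>l\<close> below
      \<open>card kernel\<close>, a subset realising \<open>l\<close> serves; otherwise one is
      constructed.\<close>
    have "\<exists>S\<in>S0. carrier G - S \<subseteq> kernel \<and> real (card (carrier G - S)) > B
        \<and> card (carrier G - S) \<noteq> card S \<and> card (carrier G - S) \<le> l"
    proof (cases "l < ?m")
      case True
      obtain S where S: "S \<in> S0" "l = card (carrier G - S)" using lL unfolding L by blast
      have Sn: "S \<in> normal_cayley_subsets G" using S(1) assms(4) by simp
      show ?thesis
        using S True lB complement_subset_kernel[OF Sn] small_ne[OF S(1)] by (intro bexI[OF _ S(1)]) auto
    next
      case ml: False
      show ?thesis
      proof (cases "?h = 2")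
        case False
        \<comment> \<open>The whole kernel is the complement; with \<open>card H\<close> at least 3
          it is smaller than \<open>S\<close>, so \<open>ne\<close> holds.\<close>
        let ?S = "(carrier G - kernel) \<union> {}"
        have S: "?S \<in> S0" unfolding assms(4)
          by (rule normal_cayley_of_kernel_part) (auto simp: union_of_conj_classes_iff)
        have C: "carrier G - ?S = kernel" using card_complement_of_kernel_part(1)[of "{}"] by simp
        have "?m * 3 \<le> ?n" unfolding mn[symmetric] using h2 False by simp
        then have "?m \<noteq> card ?S"
          using card_complement[OF cayley(3)[OF S]] m4 unfolding C by linarith
        then show ?thesis
          using ml Bm by (intro bexI[OF _ S], unfold C, intro conjI order_refl) auto
      next
        case True
        have "kernel \<noteq> {\<one>\<^bsub>G\<^esub>}" using m4 hpos by auto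
        then obtain x where x: "x \<in> kernel" "x \<noteq> \<one>\<^bsub>G\<^esub>" using one_in_kernel by blast
        have xG: "x \<in> carrier G" using x(1) kernel_subset by blast
        \<comment> \<open>With \<open>card H = 2\<close> the kernel and its complement have equal
          size, and the eigenvalue would have modulus equal to the degree. Moving \<open>x\<close>
          and its inverse into \<open>S\<close> breaks the tie and keeps the size at least m - 2 >
          \<open>B\<close>.\<close>
        let ?T = "{x, inv\<^bsub>G\<^esub> x}"
        let ?S = "(carrier G - kernel) \<union> ?T"
        have T1: "?T \<subseteq> kernel - {\<one>\<^bsub>G\<^esub>}" using x kernel_inv_closed[OF x(1)] xG by auto
        have S: "?S \<in> S0" unfolding assms(4)
          using xG
          by (intro normal_cayley_of_kernel_part[OF T1 inverse_pair_union_of_conj_classes[OF True x(1)]]) auto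
        have C: "carrier G - ?S \<subseteq> kernel" by blast
        have T12: "1 \<le> card ?T" "card ?T \<le> 2" by (auto simp: card_insert_if)
        have cC: "card (carrier G - ?S) = ?m - card ?T"
          using T1 by (intro card_complement_of_kernel_part(2)) blast
        have "card (carrier G - ?S) < ?m" using cC T12 m4 by linarith
        moreover have "real (card (carrier G - ?S)) > B" using cC T12 m4 Bm by linarith
        ultimately show ?thesis using C ml small_ne[OF S] by (intro bexI[OF _ S]) auto
      qed
    qed
    then obtain S where S: "S \<in> S0" "carrier G - S \<subseteq> kernel" "real (card (carrier G - S)) > B"
      "card (carrier G - S) \<noteq> card S" "card (carrier G - S) \<le> l" by blast
    have "1 \<le> card (carrier G - S)" using S(3) B1 by linarith
    then have "ramanujan (carrier G) (cayley_adj G S)"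
      using gl S(1,5) card_diff[OF S(1)] by simp
    then show False using not_ram[OF S(1-4)] by blast
  qed
  have "lhat = l0"
    unfolding assms(7)
  proof (rule Max_eqI)
    show "finite {l \<in> L. ?good l}" using finL by simp
    show "l \<le> l0" if "l \<in> {l \<in> L. ?good l}" for l using that bad by blast
    show "l0 \<in> {l \<in> L. ?good l}" using l0L good by blast
  qed
  then show ?thesis using part1 l0m unfolding N by blast
qed

end
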